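(* Let $W=W_1$ be the Witt algebra over an algebraically closed field $\mathbb{F}$ of characteristic $p\geq 5$. Then: (1) If $p\neq 7$, there is no non-trivial non-adjoint restricted irreducible module for $W$ with a nonzero $W$-invariant bilinear product. (2) If $p=7$, there is a unique non-trivial non-adjoint restricted irreducible module for $W$ with a nonzero $W$-invariant bilinear product. Up to isomorphism and scaling of the product, this unique module is the $7$-dimensional module $V_6$ with basis $m_0,\dots,m_6$, with the action of $W$ given, for $-1\le k\le 5$ and $0\le i\le 6$, by $$e_k(m_i)=\begin{cases}(i+4k+4)\,m_{i+k} & \text{if } 0\le i+k\le 6,\\ 0&\text{otherwise,}\end{cases}$$ and with the product $$m_i\cdot m_j=c(i,j)\,m_{i+j-3}\quad(0\le i,j\le 6,\ \text{index } i+j-3 \text{ taken modulo } 7),\qquad c(i,j)=2(j-i)(4i+j-1)(4j+i-1)\in\mathbb{F}_7\subseteq\mathbb{F}.$$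
   Context: The Witt algebra $W_1$ over a field $\mathbb{F}$ of characteristic $p$ is $\mathrm{Der}(\mathbb{F}[X]/(X^p))$; it has a basis $\{e_i:-1\le i\le p-2\}$ (with $e_i=x^{i+1}\frac{\partial}{\partial x}$, $x$ the class of $X$) such that $[e_i,e_j]=(j-i)e_{i+j}$, where $e_k=0$ for $k$ outside $\{-1,\dots,p-2\}$. It is a restricted Lie algebra with $p$-mapping determined by $e_i^{[p]}=\delta_{i,0}e_i$. A module $V$ for a restricted Lie algebra $\mathcal{L}$, with representation $\rho:\mathcal{L}\to\mathfrak{gl}(V)$, is restricted if $\rho(x^{[p]})=\rho(x)^p$ for all $x\in\mathcal{L}$. A bilinear product $\cdot:M\times M\to M$ on a module $M$ for a Lie algebra $\mathcal{L}$ is $\mathcal{L}$-invariant if $x(u\cdot v)=x(u)\cdot v+u\cdot x(v)$ for all $x\in\mathcal{L}$, $u,v\in M$. "Non-trivial" means not isomorphic to the trivial one-dimensional module, and "non-adjoint" means not isomorphic to the adjoint module of $W$. *)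

theory Defs
  imports "HOL-Analysis.Analysis" "HOL-Computational_Algebra.Polynomial"
    "HOL-Computational_Algebra.Primes"
begin

section \<open>The truncated polynomial algebra \<open>F[X]/(X^p)\<close>, where \<open>p\<close> is the characteristic of \<open>F\<close>\<close>

definition trunc_rel :: "'a::field poly \<Rightarrow> 'a poly \<Rightarrow> bool" where
  "trunc_rel f g \<longleftrightarrow> [:0, 1:] ^ CHAR('a) dvd f - g"

lemma equivp_trunc_rel: "equivp (trunc_rel :: 'a::field poly \<Rightarrow> 'a poly \<Rightarrow> bool)"
proof (rule equivpI)
  show "reflp (trunc_rel :: 'a poly \<Rightarrow> 'a poly \<Rightarrow> bool)"
    by (auto simp: reflp_def trunc_rel_def)
  show "symp (trunc_rel :: 'a poly \<Rightarrow> 'a poly \<Rightarrow> bool)"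
    unfolding symp_def trunc_rel_def by (metis dvd_minus_iff minus_diff_eq)
  show "transp (trunc_rel :: 'a poly \<Rightarrow> 'a poly \<Rightarrow> bool)"
    unfolding transp_def trunc_rel_def
    using dvd_add by fastforce
qed

quotient_type (overloaded) 'a trunc_poly = "'a::field poly" / trunc_rel
  by (rule equivp_trunc_rel)

instantiation trunc_poly :: (field) comm_ring
begin

lift_definition zero_trunc_poly :: "'a trunc_poly" is 0 .
lift_definition plus_trunc_poly :: "'a trunc_poly \<Rightarrow> 'a trunc_poly \<Rightarrow> 'a trunc_poly" is "(+)"
  unfolding trunc_rel_def by (simp add: add_diff_add)
lift_definition minus_trunc_poly :: "'a trunc_poly \<Rightarrow> 'a trunc_poly \<Rightarrow> 'a trunc_poly" is "(-)"
proof -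
  fix a b c d :: "'a poly"
  assume "trunc_rel a b" "trunc_rel c d"
  moreover have "a - c - (b - d) = (a - b) - (c - d)" by simp
  ultimately show "trunc_rel (a - c) (b - d)"
    unfolding trunc_rel_def by (metis dvd_diff)
qed
lift_definition uminus_trunc_poly :: "'a trunc_poly \<Rightarrow> 'a trunc_poly" is uminus
  unfolding trunc_rel_def by (metis dvd_minus_iff minus_diff_minus)
lift_definition times_trunc_poly :: "'a trunc_poly \<Rightarrow> 'a trunc_poly \<Rightarrow> 'a trunc_poly" is "(*)"
proof -
  fix a b c d :: "'a poly"
  assume "trunc_rel a b" "trunc_rel c d"
  moreover have "a * c - b * d = (a - b) * c + b * (c - d)" by (simp add: algebra_simps)
  ultimately show "trunc_rel (a * c) (b * d)"
    unfolding trunc_rel_def by (metis dvd_add dvd_mult dvd_mult2)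
qed

instance
  by standard (transfer; simp add: trunc_rel_def algebra_simps)+

end

lift_definition trunc_smult :: "'a::field \<Rightarrow> 'a trunc_poly \<Rightarrow> 'a trunc_poly" is smult
  unfolding trunc_rel_def by (simp add: dvd_smult flip: smult_diff_right)

lift_definition trunc_monom :: "nat \<Rightarrow> 'a::field trunc_poly" is "\<lambda>n. monom 1 n" .

lift_definition trunc_coeff :: "'a::field trunc_poly \<Rightarrow> nat \<Rightarrow> 'a"
  is "\<lambda>f n. if n < CHAR('a) then coeff f n else 0"
proof
  fix f g :: "'a poly" and n
  assume "trunc_rel f g"
  then have "monom 1 CHAR('a) dvd f - g" by (simp add: trunc_rel_def monom_altdef)
  then have "n < CHAR('a) \<Longrightarrow> coeff (f - g) n = 0" by (simp add: monom_1_dvd_iff')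
  then show "(if n < CHAR('a) then coeff f n else 0) = (if n < CHAR('a) then coeff g n else 0)"
    by simp
qed

lift_definition trunc_pderiv :: "'a::field trunc_poly \<Rightarrow> 'a trunc_poly" is pderiv
proof -
  fix f g :: "'a poly"
  assume "trunc_rel f g"
  then obtain h where h: "f - g = [:0, 1:] ^ CHAR('a) * h" by (auto simp: trunc_rel_def dvd_def)
  have "pderiv ([:0, 1:] ^ CHAR('a) :: 'a poly) = 0"
    by (simp add: pderiv_power)
  then have "pderiv f - pderiv g = [:0, 1:] ^ CHAR('a) * pderiv h"
    using h by (simp flip: pderiv_diff add: pderiv_mult)
  then show "trunc_rel (pderiv f) (pderiv g)" by (auto simp: trunc_rel_def)
qed

interpretation trunc_poly: vector_space "trunc_smult :: 'a::field \<Rightarrow> _"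
  by standard (transfer; simp add: trunc_rel_def smult_add_left smult_add_right)+

lemma trunc_smult_mult:
  "trunc_smult c f * g = trunc_smult c (f * g)" "f * trunc_smult c g = trunc_smult c (f * g)"
  by (transfer; simp add: trunc_rel_def)+


section \<open>The Witt algebra\<close>

definition is_derivation :: "('a::field trunc_poly \<Rightarrow> 'a trunc_poly) \<Rightarrow> bool" where
  "is_derivation D \<longleftrightarrow> Vector_Spaces.linear trunc_smult trunc_smult D \<and>
     (\<forall>f g. D (f * g) = D f * g + f * D g)"

lemma is_derivation_altdef:
  "is_derivation D \<longleftrightarrow> (\<forall>f g. D (f + g) = D f + D g) \<and>
     (\<forall>c f. D (trunc_smult c f) = trunc_smult c (D f)) \<and> (\<forall>f g. D (f * g) = D f * g + f * D g)"
  unfolding is_derivation_def Vector_Spaces.linear_iff by (auto simp: trunc_poly.vector_space_axioms)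

typedef (overloaded) 'a witt = "{D :: 'a::field trunc_poly \<Rightarrow> 'a trunc_poly. is_derivation D}"
  morphisms witt_apply Witt
  by (rule exI[of _ "\<lambda>_. 0"]) (simp add: is_derivation_altdef)

setup_lifting type_definition_witt

abbreviation trunc_x :: "'a::field trunc_poly" where
  "trunc_x \<equiv> trunc_monom (Suc 0)"

lemma trunc_one: "trunc_monom 0 * f = f" "f * trunc_monom 0 = f"
  by (transfer; simp add: trunc_rel_def)+

lemma trunc_monom_mult: "trunc_monom m * trunc_monom n = trunc_monom (m + n)"
  by transfer (simp add: trunc_rel_def mult_monom)

lemma trunc_monom_eq_0: "CHAR('a) \<le> n \<Longrightarrow> trunc_monom n = (0 :: 'a::field trunc_poly)"
  by transfer (simp add: trunc_rel_def monom_altdef le_imp_power_dvd)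

lemma trunc_coeff_monom:
  "trunc_coeff (trunc_monom m :: 'a::field trunc_poly) n = (if n < CHAR('a) \<and> m = n then 1 else 0)"
  by transfer auto

lemma trunc_expansion:
  "f = (\<Sum>n<CHAR('a). trunc_smult (trunc_coeff f n) (trunc_monom n))" for f :: "'a::field trunc_poly"
proof -
  have "abs_trunc_poly q = (\<Sum>n<CHAR('a). trunc_smult (coeff q n) (trunc_monom n))" for q :: "'a poly"
  proof -
    have sum: "(\<Sum>n\<in>A. abs_trunc_poly (h n)) = abs_trunc_poly (\<Sum>n\<in>A. h n)"
      if "finite A" for A and h :: "nat \<Rightarrow> 'a poly"
      using that
      by (induction A rule: finite_induct) (auto simp: zero_trunc_poly.abs_eq plus_trunc_poly.abs_eq)
    have "monom 1 CHAR('a) dvd q - (\<Sum>n<CHAR('a). monom (coeff q n) n)"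
      by (simp add: monom_1_dvd_iff' coeff_sum)
    then have "abs_trunc_poly q = abs_trunc_poly (\<Sum>n<CHAR('a). monom (coeff q n) n)"
      by (simp add: trunc_poly.abs_eq_iff trunc_rel_def monom_altdef)
    then show ?thesis
      by (simp add: trunc_smult.abs_eq trunc_monom.abs_eq smult_monom sum)
  qed
  note abs = this
  obtain q where q: "f = abs_trunc_poly q"
    by (metis Quotient_trunc_poly Quotient_abs_rep)
  show ?thesis
    unfolding q by (subst abs) (auto simp: trunc_coeff.abs_eq intro!: sum.cong)
qed

lemma trunc_trivial:
  fixes f g :: "'a::field trunc_poly"
  assumes "CHAR('a) = 0"
  shows "f = g"
proof -
  obtain q r where "f = abs_trunc_poly q" "g = abs_trunc_poly r"
    by (metis Quotient_trunc_poly Quotient_abs_rep)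
  with assms show ?thesis by (simp add: trunc_poly.abs_eq_iff trunc_rel_def)
qed

lemma trunc_pderiv_monom: "trunc_pderiv (trunc_monom n) = trunc_smult (of_nat n) (trunc_monom (n - 1))"
  by transfer (simp add: trunc_rel_def pderiv_monom smult_monom)

lemma is_derivation_one: "is_derivation D \<Longrightarrow> D (trunc_monom 0) = 0"
  unfolding is_derivation_altdef by (metis add_cancel_right_right trunc_one)

lemma is_derivation_zero: "is_derivation D \<Longrightarrow> D 0 = 0"
  unfolding is_derivation_altdef by (metis add_cancel_right_right)

lemma is_derivation_eq:
  fixes D :: "'a::field trunc_poly \<Rightarrow> 'a trunc_poly"
  assumes D: "is_derivation D"
  shows "D f = D trunc_x * trunc_pderiv f"
proof -
  have pd0: "trunc_pderiv 0 = (0 :: 'a trunc_poly)"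
    by transfer (simp add: trunc_rel_def)
  have "D (abs_trunc_poly q) = D trunc_x * trunc_pderiv (abs_trunc_poly q)" for q
  proof (induction q)
    case 0
    then show ?case
      by (simp add: is_derivation_zero[OF D] pd0 flip: zero_trunc_poly.abs_eq)
  next
    case (pCons a q)
    have eq: "abs_trunc_poly (pCons a q) = trunc_smult a (trunc_monom 0) + trunc_x * abs_trunc_poly q"
      by (simp add: trunc_monom.abs_eq trunc_smult.abs_eq times_trunc_poly.abs_eq
          plus_trunc_poly.abs_eq monom_altdef)
    have pd: "trunc_pderiv (abs_trunc_poly (pCons a q)) =
                abs_trunc_poly q + trunc_x * trunc_pderiv (abs_trunc_poly q)"
      by (simp add: trunc_pderiv.abs_eq trunc_monom.abs_eq times_trunc_poly.abs_eq
          plus_trunc_poly.abs_eq pderiv_pCons monom_altdef)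
    have "D (abs_trunc_poly (pCons a q)) =
            D trunc_x * abs_trunc_poly q + trunc_x * D (abs_trunc_poly q)"
      unfolding eq using D is_derivation_one[OF D] by (simp add: is_derivation_altdef)
    then show ?case
      unfolding pd pCons.IH by (simp add: algebra_simps)
  qed
  then show ?thesis
    by (metis Quotient_trunc_poly Quotient_abs_rep)
qed

lemma is_derivation_times_pderiv:
  fixes h :: "'a::field trunc_poly"
  shows "is_derivation (\<lambda>f. h * trunc_pderiv f)"
proof -
  have add: "trunc_pderiv (f + g) = trunc_pderiv f + trunc_pderiv g" for f g :: "'a trunc_poly"
    by transfer (simp add: trunc_rel_def pderiv_add)
  have smult: "trunc_pderiv (trunc_smult c f) = trunc_smult c (trunc_pderiv f)" for c and f :: "'a trunc_poly"
    by transfer (simp add: trunc_rel_def pderiv_smult)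
  have mult: "trunc_pderiv (f * g) = f * trunc_pderiv g + g * trunc_pderiv f" for f g :: "'a trunc_poly"
    by transfer (simp add: trunc_rel_def pderiv_mult)
  show ?thesis
    unfolding is_derivation_altdef by (simp add: add smult mult trunc_smult_mult algebra_simps)
qed

instantiation witt :: (field) ab_group_add
begin

lift_definition zero_witt :: "'a witt" is "\<lambda>_. 0"
  by (simp add: is_derivation_altdef)
lift_definition plus_witt :: "'a witt \<Rightarrow> 'a witt \<Rightarrow> 'a witt" is "\<lambda>D E f. D f + E f"
  by (simp add: is_derivation_altdef algebra_simps trunc_poly.scale_right_distrib)
lift_definition minus_witt :: "'a witt \<Rightarrow> 'a witt \<Rightarrow> 'a witt" is "\<lambda>D E f. D f - E f"
  by (simp add: is_derivation_altdef algebra_simps trunc_poly.scale_right_diff_distrib)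
lift_definition uminus_witt :: "'a witt \<Rightarrow> 'a witt" is "\<lambda>D f. - D f"
  by (simp add: is_derivation_altdef algebra_simps trunc_poly.scale_minus_right)

instance
  by standard (transfer; simp add: algebra_simps)+

end

lift_definition witt_scale :: "'a::field \<Rightarrow> 'a witt \<Rightarrow> 'a witt" is "\<lambda>c D f. trunc_smult c (D f)"
  unfolding is_derivation_altdef
  by (simp add: trunc_poly.scale_right_distrib trunc_smult_mult mult.commute)

lift_definition witt_bracket :: "'a::field witt \<Rightarrow> 'a witt \<Rightarrow> 'a witt" is
  "\<lambda>D E f. D (E f) - E (D f)"
  unfolding is_derivation_altdef
  by (simp add: trunc_poly.scale_right_diff_distrib algebra_simps)

lemma is_derivation_funpow:
  fixes D :: "'a::field trunc_poly \<Rightarrow> 'a trunc_poly"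
  assumes D: "is_derivation D"
  shows "(D ^^ n) (f + g) = (D ^^ n) f + (D ^^ n) g"
    and "(D ^^ n) (trunc_smult c f) = trunc_smult c ((D ^^ n) f)"
    and "(D ^^ n) (f * g) =
           (\<Sum>k\<le>n. trunc_smult (of_nat (n choose k)) ((D ^^ k) f * (D ^^ (n - k)) g))"
proof -
  show "(D ^^ n) (f + g) = (D ^^ n) f + (D ^^ n) g"
    by (induction n) (use D in \<open>auto simp: is_derivation_altdef\<close>)
  show "(D ^^ n) (trunc_smult c f) = trunc_smult c ((D ^^ n) f)"
    by (induction n) (use D in \<open>auto simp: is_derivation_altdef\<close>)
  have add: "D (x + y) = D x + D y" and smult: "D (trunc_smult r x) = trunc_smult r (D x)"
    and mult: "D (x * y) = D x * y + x * D y" for x y r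
    using D by (auto simp: is_derivation_altdef)
  have sum: "D (\<Sum>k\<in>A. h k) = (\<Sum>k\<in>A. D (h k))" if "finite A" for A and h :: "nat \<Rightarrow> 'a trunc_poly"
    using that by (induction A rule: finite_induct) (auto simp: add is_derivation_zero[OF D])
  show "(D ^^ n) (f * g) =
          (\<Sum>k\<le>n. trunc_smult (of_nat (n choose k)) ((D ^^ k) f * (D ^^ (n - k)) g))"
  proof (induction n)
    case 0
    then show ?case by simp
  next
    case (Suc n)
    let ?a = "\<lambda>k l. (D ^^ k) f * (D ^^ l) g"
    let ?t = "\<lambda>k. trunc_smult (of_nat (n choose k)) (?a k (Suc n - k))"
    have "(D ^^ Suc n) (f * g) =
        (\<Sum>k\<le>n. trunc_smult (of_nat (n choose k)) (?a (Suc k) (n - k) + ?a k (Suc n - k)))"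
      by (simp add: Suc.IH sum smult mult Suc_diff_le)
    also have "\<dots> = (\<Sum>k\<le>n. trunc_smult (of_nat (n choose k)) (?a (Suc k) (n - k))) + (\<Sum>k\<le>n. ?t k)"
      by (simp only: trunc_poly.scale_right_distrib sum.distrib)
    also have "(\<Sum>k\<le>n. ?t k) = (\<Sum>k\<le>Suc n. ?t k)"
      by (simp add: binomial_eq_0)
    also have "\<dots> = ?t 0 + (\<Sum>k\<le>n. trunc_smult (of_nat (n choose Suc k)) (?a (Suc k) (n - k)))"
      by (subst sum.atMost_Suc_shift) simp
    also have "(\<Sum>k\<le>n. trunc_smult (of_nat (n choose k)) (?a (Suc k) (n - k))) + \<dots> =
        ?t 0 + (\<Sum>k\<le>n. trunc_smult (of_nat (Suc n choose Suc k)) (?a (Suc k) (n - k)))"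
      by (simp add: sum.distrib trunc_poly.scale_left_distrib algebra_simps)
    also have "\<dots> = (\<Sum>k\<le>Suc n. trunc_smult (of_nat (Suc n choose k)) (?a k (Suc n - k)))"
      by (subst sum.atMost_Suc_shift) simp
    finally show ?case .
  qed
qed

text \<open>The standard \<open>p\<close>-mapping on derivations is the \<open>p\<close>-fold composition; see \<open>witt_pmap_e\<close>.\<close>

lift_definition witt_pmap :: "'a::field witt \<Rightarrow> 'a witt" is "\<lambda>D. D ^^ CHAR('a)"
proof -
  fix D :: "'a trunc_poly \<Rightarrow> 'a trunc_poly"
  assume D: "is_derivation D"
  let ?p = "CHAR('a)"
  show "is_derivation (D ^^ ?p)"
  proof (cases "?p = 0")
    case True
    then show ?thesis by (auto simp: is_derivation_altdef intro: trunc_trivial)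
  next
    case False
    then have p: "prime ?p" using prime_CHAR_semidom by blast
    have "(D ^^ ?p) (f * g) = (D ^^ ?p) f * g + f * (D ^^ ?p) g" for f g
    proof -
      let ?t = "\<lambda>k. trunc_smult (of_nat (?p choose k)) ((D ^^ k) f * (D ^^ (?p - k)) g)"
      have "?t k = 0" if "k \<in> {..?p} - {0, ?p}" for k
      proof -
        have "?p dvd (?p choose k)" using that p False by (intro dvd_choose_prime) auto
        then have "(of_nat (?p choose k) :: 'a) = 0" by (simp add: of_nat_eq_0_iff_char_dvd)
        then show ?thesis by simp
      qed
      then have "sum ?t {..?p} = sum ?t {0, ?p}" by (intro sum.mono_neutral_right) auto
      with False show ?thesis by (simp add: is_derivation_funpow(3)[OF D] add.commute)
    qed
    then show ?thesis by (simp add: is_derivation_altdef is_derivation_funpow(1,2)[OF D])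
  qed
qed

lift_definition witt_e :: "int \<Rightarrow> 'a::field witt" is
  "\<lambda>k f. if k < -1 then 0 else trunc_monom (nat (k + 1)) * trunc_pderiv f"
proof -
  fix k :: int
  have "is_derivation (\<lambda>_. 0 :: 'a trunc_poly)" by (simp add: is_derivation_altdef)
  then show "is_derivation (\<lambda>f :: 'a trunc_poly.
      if k < -1 then 0 else trunc_monom (nat (k + 1)) * trunc_pderiv f)"
    using is_derivation_times_pderiv by (cases "k < -1") simp_all
qed

text \<open>The coordinate of \<open>D\<close> with respect to \<open>e\<^sub>k\<close>: it is the coefficient of \<open>x^(k+1)\<close> in \<open>D x\<close>.\<close>

definition witt_coeff :: "'a::field witt \<Rightarrow> int \<Rightarrow> 'a" where
  "witt_coeff D k = trunc_coeff (witt_apply D trunc_x) (nat (k + 1))"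

interpretation witt: vector_space "witt_scale :: 'a::field \<Rightarrow> _"
proof
  fix a b :: 'a and D E :: "'a witt"
  have eqI: "F = G" if "\<And>f. witt_apply F f = witt_apply G f" for F G :: "'a witt"
    using that witt_apply_inject by blast
  show "witt_scale a (D + E) = witt_scale a D + witt_scale a E"
    by (rule eqI) (simp only: witt_scale.rep_eq plus_witt.rep_eq trunc_poly.scale_right_distrib)
  show "witt_scale (a + b) D = witt_scale a D + witt_scale b D"
    by (rule eqI) (simp only: witt_scale.rep_eq plus_witt.rep_eq trunc_poly.scale_left_distrib)
  show "witt_scale a (witt_scale b D) = witt_scale (a * b) D"
    by (rule eqI) (simp only: witt_scale.rep_eq trunc_poly.scale_scale)
  show "witt_scale 1 D = D"
    by (rule eqI) (simp only: witt_scale.rep_eq trunc_poly.scale_one)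
qed

lemma witt_eqI: "witt_apply D trunc_x = witt_apply E trunc_x \<Longrightarrow> D = E"
proof -
  assume eq: "witt_apply D trunc_x = witt_apply E trunc_x"
  have der: "is_derivation (witt_apply D)" "is_derivation (witt_apply E)"
    using witt_apply by blast+
  have "witt_apply D f = witt_apply E f" for f
    unfolding is_derivation_eq[OF der(1), of f] is_derivation_eq[OF der(2), of f] eq ..
  then have "witt_apply D = witt_apply E" by (rule ext)
  then show "D = E" by (simp only: witt_apply_inject)
qed

lemma trunc_pderiv_x: "trunc_pderiv trunc_x = trunc_monom 0"
  by (simp add: trunc_pderiv_monom)

lemma witt_e_x: "witt_apply (witt_e k) trunc_x = (if k < -1 then 0 else trunc_monom (nat (k + 1)))"
  by (simp add: witt_e.rep_eq trunc_pderiv_x trunc_one)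

lemma witt_e_eq_0: "k \<notin> {-1..int CHAR('a) - 2} \<Longrightarrow> witt_e k = (0 :: 'a::field witt)"
  by (rule witt_eqI) (auto simp: witt_e_x zero_witt.rep_eq trunc_monom_eq_0)

lemma witt_coeff_e:
  "j \<in> {-1..int CHAR('a) - 2} \<Longrightarrow> k \<in> {-1..int CHAR('a) - 2} \<Longrightarrow>
     witt_coeff (witt_e j :: 'a::field witt) k = (if j = k then 1 else 0)"
  by (auto simp: witt_coeff_def witt_e_x trunc_coeff_monom)

lemma witt_expansion:
  "D = (\<Sum>k\<in>{-1..int CHAR('a) - 2}. witt_scale (witt_coeff D k) (witt_e k))" for D :: "'a::field witt"
proof (rule witt_eqI)
  let ?K = "{-1..int CHAR('a) - 2}"
  have sum: "witt_apply (\<Sum>k\<in>A. h k) f = (\<Sum>k\<in>A. witt_apply (h k) f)"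
    if "finite A" for A f and h :: "int \<Rightarrow> 'a witt"
    using that by (induction A rule: finite_induct) (auto simp: zero_witt.rep_eq plus_witt.rep_eq)
  have "witt_apply (\<Sum>k\<in>?K. witt_scale (witt_coeff D k) (witt_e k)) trunc_x =
      (\<Sum>k\<in>?K. trunc_smult (trunc_coeff (witt_apply D trunc_x) (nat (k + 1))) (trunc_monom (nat (k + 1))))"
    by (auto simp: sum witt_scale.rep_eq witt_coeff_def witt_e_x intro!: sum.cong)
  also have "\<dots> = (\<Sum>n<CHAR('a). trunc_smult (trunc_coeff (witt_apply D trunc_x) n) (trunc_monom n))"
    by (rule sum.reindex_bij_witness[of _ "\<lambda>n. int n - 1" "\<lambda>k. nat (k + 1)"]) auto
  also have "\<dots> = witt_apply D trunc_x"
    by (rule trunc_expansion[symmetric])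
  finally show "witt_apply D trunc_x =
      witt_apply (\<Sum>k\<in>?K. witt_scale (witt_coeff D k) (witt_e k)) trunc_x" ..
qed

lemma witt_bracket_e:
  assumes "i \<ge> -1" "j \<ge> -1"
  shows "witt_bracket (witt_e i) (witt_e j) = witt_scale (of_int (j - i)) (witt_e (i + j) :: 'a::field witt)"
proof (rule witt_eqI)
  define m n where "m = nat (i + 1)" and "n = nat (j + 1)"
  have i: "i = int m - 1" and j: "j = int n - 1" using assms by (auto simp: m_def n_def)
  have apply_e: "witt_apply (witt_e (int a - 1) :: 'a witt) (trunc_monom b) =
      trunc_smult (of_nat b) (trunc_monom (a + b - 1))" for a b
  proof (cases "b = 0")
    case True
    then show ?thesis by (simp add: witt_e.rep_eq trunc_pderiv_monom)
  next
    case False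
    then show ?thesis
      by (simp add: witt_e.rep_eq trunc_pderiv_monom trunc_smult_mult trunc_monom_mult)
  qed
  have e_x: "witt_apply (witt_e (int a - 1) :: 'a witt) trunc_x = trunc_monom a" for a
    by (simp add: witt_e_x)
  have "witt_apply (witt_bracket (witt_e i) (witt_e j)) trunc_x =
      trunc_smult (of_nat n - of_nat m :: 'a) (trunc_monom (m + n - 1))"
    by (simp add: witt_bracket.rep_eq i j e_x apply_e trunc_poly.scale_left_diff_distrib add.commute)
  also have "\<dots> = witt_apply (witt_scale (of_int (j - i)) (witt_e (i + j))) trunc_x"
  proof (cases "m + n = 0")
    case True
    then show ?thesis by (simp add: witt_scale.rep_eq zero_witt.rep_eq i j)
  next
    case False
    then have "nat (i + j + 1) = m + n - 1" "\<not> i + j < -1" by (auto simp: i j)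
    then show ?thesis by (simp add: witt_scale.rep_eq witt_e_x) (simp add: i j)
  qed
  finally show "witt_apply (witt_bracket (witt_e i) (witt_e j)) trunc_x =
      witt_apply (witt_scale (of_int (j - i)) (witt_e (i + j)) :: 'a witt) trunc_x" .
qed

lemma witt_pmap_e:
  assumes "CHAR('a::field) > 0"
  shows "witt_pmap (witt_e i) = (if i = 0 then witt_e i else 0 :: 'a witt)"
proof (rule witt_eqI)
  let ?e = "witt_apply (witt_e i :: 'a witt)"
  have p: "prime CHAR('a)" using assms prime_CHAR_semidom by blast
  then obtain n where n: "CHAR('a) = Suc (Suc n)"
    by (metis One_nat_def not_prime_0 not_prime_1 nat.exhaust)
  have zero: "?e 0 = 0"
    by (simp add: is_derivation_zero witt_apply[simplified])
  then have zeros: "(?e ^^ k) 0 = 0" for k by (induction k) auto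
  consider "i < -1" | "i = -1" | "i = 0" | "i > 0" by linarith
  then have "(?e ^^ CHAR('a)) trunc_x = (if i = 0 then trunc_x else 0)"
  proof cases
    case 1
    then show ?thesis unfolding n by (simp add: witt_e.rep_eq)
  next
    case 2
    then have "(?e ^^ CHAR('a)) trunc_x = (?e ^^ n) 0"
      unfolding n by (simp only: funpow_Suc_right o_apply)
        (simp add: witt_e.rep_eq trunc_pderiv_monom trunc_one)
    with 2 zeros show ?thesis by simp
  next
    case 3
    have "(?e ^^ k) trunc_x = trunc_x" for k
      by (induction k) (auto simp: 3 witt_e_x)
    with 3 show ?thesis by simp
  next
    case 4
    have "\<exists>c. (?e ^^ k) trunc_x = trunc_smult c (trunc_monom (Suc (k * nat i)))" for k
    proof (induction k)
      case 0
      show ?case by (rule exI[of _ 1]) simp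
    next
      case (Suc k)
      then obtain c where c: "(?e ^^ k) trunc_x = trunc_smult c (trunc_monom (Suc (k * nat i)))" by blast
      have "is_derivation ?e" using witt_apply by blast
      then have "(?e ^^ Suc k) trunc_x = trunc_smult c (?e (trunc_monom (Suc (k * nat i))))"
        by (simp add: c is_derivation_altdef)
      also have "?e (trunc_monom (Suc (k * nat i))) =
          trunc_smult (of_nat (Suc (k * nat i))) (trunc_monom (nat (i + 1)) * trunc_monom (k * nat i))"
        using 4 by (simp add: witt_e.rep_eq trunc_pderiv_monom trunc_smult_mult del: of_nat_Suc)
      also have "trunc_monom (nat (i + 1)) * trunc_monom (k * nat i) =
          (trunc_monom (Suc (Suc k * nat i)) :: 'a trunc_poly)"
        using 4 by (simp add: trunc_monom_mult nat_add_distrib)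
      finally show ?case by auto
    qed
    then obtain c where "(?e ^^ CHAR('a)) trunc_x = trunc_smult c (trunc_monom (Suc (CHAR('a) * nat i)))"
      by blast
    moreover have "CHAR('a) \<le> Suc (CHAR('a) * nat i)"
      using 4 by (metis le_SucI mult_le_mono2 nat_mult_1_right One_nat_def Suc_leI zero_less_nat_eq)
    ultimately show ?thesis using 4 by (simp add: trunc_monom_eq_0)
  qed
  then show "witt_apply (witt_pmap (witt_e i)) trunc_x =
      witt_apply (if i = 0 then witt_e i else 0 :: 'a witt) trunc_x"
    by (simp add: witt_pmap.rep_eq witt_e_x zero_witt.rep_eq)
qed


section \<open>Modules for the Witt algebra\<close>

locale witt_module = vector_space scale
  for scale :: "'a::field \<Rightarrow> 'v::ab_group_add \<Rightarrow> 'v" +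
  fixes act :: "'a witt \<Rightarrow> 'v \<Rightarrow> 'v"
  assumes linear_act: "Vector_Spaces.linear scale scale (act D)"
    and linear_rep: "Vector_Spaces.linear witt_scale scale (\<lambda>D. act D v)"
    and act_bracket: "act (witt_bracket D E) v = act D (act E v) - act E (act D v)"

definition witt_restricted :: "('a::field witt \<Rightarrow> 'v \<Rightarrow> 'v) \<Rightarrow> bool" where
  "witt_restricted act \<longleftrightarrow> (\<forall>D. act (witt_pmap D) = act D ^^ CHAR('a))"

definition witt_irreducible ::
  "('a::field \<Rightarrow> 'v::ab_group_add \<Rightarrow> 'v) \<Rightarrow> ('a witt \<Rightarrow> 'v \<Rightarrow> 'v) \<Rightarrow> bool" where
  "witt_irreducible scl act \<longleftrightarrow> (UNIV :: 'v set) \<noteq> {0} \<and>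
     (\<forall>U. module.subspace scl U \<and> (\<forall>D. \<forall>u\<in>U. act D u \<in> U) \<longrightarrow> U = {0} \<or> U = UNIV)"

definition witt_module_iso ::
  "('a::field \<Rightarrow> 'v::ab_group_add \<Rightarrow> 'v) \<Rightarrow> ('a witt \<Rightarrow> 'v \<Rightarrow> 'v) \<Rightarrow>
   ('a \<Rightarrow> 'w::ab_group_add \<Rightarrow> 'w) \<Rightarrow> ('a witt \<Rightarrow> 'w \<Rightarrow> 'w) \<Rightarrow> ('v \<Rightarrow> 'w) \<Rightarrow> bool" where
  "witt_module_iso s1 a1 s2 a2 \<phi> \<longleftrightarrow>
     Vector_Spaces.linear s1 s2 \<phi> \<and> bij \<phi> \<and> (\<forall>D v. \<phi> (a1 D v) = a2 D (\<phi> v))"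

definition witt_trivial ::
  "('a::field \<Rightarrow> 'v::ab_group_add \<Rightarrow> 'v) \<Rightarrow> ('a witt \<Rightarrow> 'v \<Rightarrow> 'v) \<Rightarrow> bool" where
  "witt_trivial scl act \<longleftrightarrow>
     (\<exists>\<phi>. witt_module_iso scl act ((*) :: 'a \<Rightarrow> 'a \<Rightarrow> 'a) (\<lambda>_ _. 0) \<phi>)"

definition witt_adjoint ::
  "('a::field \<Rightarrow> 'v::ab_group_add \<Rightarrow> 'v) \<Rightarrow> ('a witt \<Rightarrow> 'v \<Rightarrow> 'v) \<Rightarrow> bool" where
  "witt_adjoint scl act \<longleftrightarrow> (\<exists>\<phi>. witt_module_iso scl act witt_scale witt_bracket \<phi>)"

definition witt_invariant_product ::
  "('a::field \<Rightarrow> 'v::ab_group_add \<Rightarrow> 'v) \<Rightarrow> ('a witt \<Rightarrow> 'v \<Rightarrow> 'v) \<Rightarrow> ('v \<Rightarrow> 'v \<Rightarrow> 'v) \<Rightarrow> bool" where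
  "witt_invariant_product scl act prd \<longleftrightarrow>
     (\<forall>u. Vector_Spaces.linear scl scl (\<lambda>v. prd u v)) \<and>
     (\<forall>v. Vector_Spaces.linear scl scl (\<lambda>u. prd u v)) \<and>
     (\<forall>D u v. act D (prd u v) = prd (act D u) v + prd u (act D v))"

definition witt_module_with_product ::
  "('a::field \<Rightarrow> 'v::ab_group_add \<Rightarrow> 'v) \<Rightarrow> ('a witt \<Rightarrow> 'v \<Rightarrow> 'v) \<Rightarrow> ('v \<Rightarrow> 'v \<Rightarrow> 'v) \<Rightarrow> bool" where
  "witt_module_with_product scl act prd \<longleftrightarrow>
     witt_module scl act \<and> witt_restricted act \<and> witt_irreducible scl act \<and>
     \<not> witt_trivial scl act \<and> \<not> witt_adjoint scl act \<and>
     witt_invariant_product scl act prd \<and> (\<exists>u v. prd u v \<noteq> 0)"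


section \<open>The module \<open>V\<^sub>6\<close> in characteristic 7\<close>

text \<open>
  The coordinates are indexed by the numeral type \<open>7\<close>, i.e. the integers modulo 7, so
  \<open>V6_basis i\<close> depends only on \<open>i\<close> modulo 7. The action and the product are the (bi)linear extensions
  of the formulas on basis elements; see \<open>V6_act_basis\<close> and \<open>V6_prod_basis\<close>.
\<close>

definition V6_basis :: "int \<Rightarrow> 'a::field ^ 7" where
  "V6_basis i = axis (of_int i) 1"

definition V6_act :: "'a::field witt \<Rightarrow> 'a ^ 7 \<Rightarrow> 'a ^ 7" where
  "V6_act D v = (\<Sum>k\<in>{-1..5::int}. \<Sum>i\<in>{0..6::int}. (witt_coeff D k * v $ of_int i) *s
     (if 0 \<le> i + k \<and> i + k \<le> 6 then of_int (i + 4 * k + 4) *s V6_basis (i + k) else 0))"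

definition V6_c :: "int \<Rightarrow> int \<Rightarrow> int" where
  "V6_c i j = 2 * (j - i) * (4 * i + j - 1) * (4 * j + i - 1)"

definition V6_prod :: "'a::field ^ 7 \<Rightarrow> 'a ^ 7 \<Rightarrow> 'a ^ 7" where
  "V6_prod u v = (\<Sum>i\<in>{0..6::int}. \<Sum>j\<in>{0..6::int}. (u $ of_int i * v $ of_int j) *s
     (of_int (V6_c i j) *s V6_basis (i + j - 3)))"

lemma V6_basis_nth:
  assumes "i \<in> {0..6}" "j \<in> {0..6}"
  shows "V6_basis i $ of_int j = (if i = j then 1 else 0 :: 'a::field)"
proof -
  have rep: "Rep_bit1 (of_int z :: 7) = z mod 7" for z
    using bit1.Rep_Abs_mod[where 'a = "1 bit1"] by (simp add: bit1.of_int_eq)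
  have "(of_int i :: 7) = of_int j \<longleftrightarrow> i = j"
    unfolding Rep_bit1_inject[symmetric] rep using assms by simp
  then show ?thesis by (auto simp: V6_basis_def axis_def)
qed

lemma V6_act_basis:
  assumes "CHAR('a::field) = 7" "k \<in> {-1..5}" "i \<in> {0..6}"
  shows "V6_act (witt_e k) (V6_basis i :: 'a ^ 7) =
           (if 0 \<le> i + k \<and> i + k \<le> 6 then of_int (i + 4 * k + 4) *s V6_basis (i + k) else 0)"
proof -
  let ?t = "\<lambda>k i. if 0 \<le> i + k \<and> i + k \<le> 6 then of_int (i + 4 * k + 4) *s V6_basis (i + k) else (0 :: 'a ^ 7)"
  have "V6_act (witt_e k) (V6_basis i) =
     (\<Sum>k'\<in>{-1..5::int}. \<Sum>i'\<in>{0..6::int}. if i' = i then (if k' = k then ?t k i else 0) else 0)"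
    unfolding V6_act_def
    by (intro sum.cong refl) (use assms in \<open>simp add: V6_basis_nth witt_coeff_e\<close>)
  also have "\<dots> = ?t k i" using assms by (simp add: sum.delta)
  finally show ?thesis .
qed

lemma V6_prod_basis:
  assumes "i \<in> {0..6}" "j \<in> {0..6}"
  shows "V6_prod (V6_basis i) (V6_basis j :: 'a::field ^ 7) =
           of_int (V6_c i j) *s V6_basis ((i + j - 3) mod 7)"
proof -
  let ?t = "\<lambda>i j. of_int (V6_c i j) *s V6_basis (i + j - 3) :: 'a ^ 7"
  have "V6_prod (V6_basis i) (V6_basis j) =
     (\<Sum>i'\<in>{0..6::int}. \<Sum>j'\<in>{0..6::int}. if j' = j then (if i' = i then ?t i j else 0) else 0)"
    unfolding V6_prod_def
    by (intro sum.cong refl) (use assms in \<open>simp add: V6_basis_nth\<close>)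
  also have "\<dots> = ?t i j" using assms by (simp add: sum.delta)
  also have "V6_basis (i + j - 3) = (V6_basis ((i + j - 3) mod 7) :: 'a ^ 7)"
    by (simp add: V6_basis_def bit1.of_int_eq)
  finally show ?thesis .
qed

end

theory Submission
  imports Defs
begin

text \<open>
  Write \<open>m\<^sub>i\<close> for the tensor density \<open>x\<^sup>i (dx)\<^sup>b\<close>, on which \<open>W\<close> acts by
  \<open>e\<^sub>k m\<^sub>i = (i + b (k + 1)) m\<^sub>i\<^sub>+\<^sub>k\<close>. The adjoint module is the case \<open>b = -1\<close>, and \<open>V\<^sub>6\<close> is the
  case \<open>b = 4\<close>, \<open>p = 7\<close>.

  A restricted irreducible module \<open>M\<close> contains a vector that is killed by all \<open>e\<^sub>k\<close> with
  \<open>k \<ge> 1\<close> and on which \<open>e\<^sub>0\<close> acts by an element of the prime field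
  (\<open>exists_highest_weight_vector\<close>). Applying \<open>e\<^sub>-\<^sub>1\<close> repeatedly to it and rescaling produces vectors
  \<open>m\<^sub>p\<^sub>-\<^sub>1, \<dots>, m\<^sub>0\<close> that span \<open>M\<close> and satisfy the formula above, some of them possibly zero
  (\<open>restricted_irreducible_is_density_module\<close>). If \<open>M\<close> is not trivial, then irreducibility leaves
  only two possibilities (\<open>lowest_index\<close>): all \<open>m\<^sub>i\<close> are nonzero and \<open>b\<close> is neither \<open>0\<close>
  nor \<open>1\<close>, or \<open>b = 0\<close> and exactly \<open>m\<^sub>0\<close> vanishes.

  Let \<open>m\<^sub>r\<close> be the lowest nonzero vector and \<open>\<kappa>\<close> the coordinate of \<open>m\<^sub>r\<close>. The kernel of \<open>\<kappa>\<close> contains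
  no nonzero submodule, so an invariant product is determined by the bilinear form
  \<open>\<kappa>(u \<cdot> v)\<close> (\<open>invariant_product_eq_0\<close>). Since \<open>\<kappa>\<close> is killed by \<open>e\<^sub>k\<close> for \<open>k \<ge> 1\<close> and is an eigenvector
  of \<open>e\<^sub>0\<close>, this form is invariant under the positive part of \<open>W\<close> and pairs \<open>m\<^sub>i\<close> with
  \<open>m\<^sub>j\<close> only if \<open>i + j + b = r\<close> in the field. What remains is at most two finite sequences
  \<open>f(i) = \<kappa>(m\<^sub>i \<cdot> m\<^sub>\<sigma>\<^sub>-\<^sub>i)\<close> that satisfy one recursion of step 1 from \<open>e\<^sub>1\<close> and one of step 2
  from \<open>e\<^sub>2\<close>. Comparing the two shows that \<open>f(i)\<close> vanishes unless \<open>i\<close> is a root of a quadratic polynomial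
  (\<open>chain_quadratic_annihilates\<close>), and this forces \<open>f = 0\<close> except for \<open>b = -1\<close> and for
  \<open>p = 7\<close>, \<open>b = 4\<close>, where \<open>f\<close> is determined by \<open>f(0)\<close>
  (\<open>form_invariant_under_positive_part_vanishes\<close>). If \<open>b = 0\<close>, the recursion from \<open>e\<^sub>1\<close> suffices to see that
  the form is zero (\<open>form_zero_quotient\<close>). This gives part (1) and the uniqueness in part (2).

  For the existence in part (2), note that \<open>4 = -3\<close> in characteristic 7, so \<open>V\<^sub>6\<close> is the third tensor power
  of the adjoint module over the truncated polynomial algebra. As \<open>p\<close>-th powers of derivations are
  derivations, it inherits restrictedness from the adjoint module (\<open>tensor_density_restricted\<close>). Invariance
  of the product is a finite check for the two generators \<open>e\<^sub>-\<^sub>1\<close> and \<open>e\<^sub>2\<close> of \<open>W\<close>.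
\<close>


section \<open>Recursions for invariant forms\<close>

lemma of_nat_eq_iff_less_CHAR:
  assumes "m < CHAR('a)" "n < CHAR('a)"
  shows "(of_nat m = (of_nat n :: 'a::field)) \<longleftrightarrow> m = n"
proof -
  have "(of_nat m :: 'a) \<noteq> of_nat n" if "m < n" "n < CHAR('a)" for m n :: nat
    using that of_nat_eq_iff_char_dvd[OF that(1), where ?'a = 'a] by (auto dest: dvd_imp_le)
  then show ?thesis using assms by (metis linorder_neqE_nat)
qed

text \<open>
  The polynomial in \<open>x\<close> that is left, up to the factor \<open>s\<close>, when two steps of the recursion
  for \<open>e\<^sub>1\<close> are compared with one step of the recursion for \<open>e\<^sub>2\<close>, where \<open>b = -s\<close>; the cubic terms
  of the two sides cancel.
\<close>

definition chain_quadratic :: "'a::field \<Rightarrow> 'a \<Rightarrow> 'a" where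
  "chain_quadratic s x = x\<^sup>2 + (2 - s) * x - (1 + s) * (2 + 11 * s)"

lemma chain_quadratic_annihilates:
  fixes s x f0 f1 f2 :: "'a::field"
  assumes "s \<noteq> 0"
    and "(x - 2 * s) * f1 = (x + 1 + s) * f0"
    and "(x + 1 - 2 * s) * f2 = (x + 2 + s) * f1"
    and "(x - 3 * s) * f2 = (x + 2 + 2 * s) * f0"
  shows "chain_quadratic s x = 0 \<or> f0 = 0 \<and> f2 = 0"
proof -
  have "s * chain_quadratic s x * f0 = 0" "s * chain_quadratic s x * f2 = 0"
    using assms(2-4) unfolding chain_quadratic_def by algebra+
  with assms(1) show ?thesis by auto
qed

text \<open>
  If \<open>f i \<noteq> 0\<close> at an inner position, then both \<open>i\<close> and \<open>i - 2\<close> are roots of the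
  quadratic, which forces \<open>2 i = s\<close>. So the neighbours at distance 1 and 2 vanish, and the two recursions at
  \<open>i\<close> become \<open>3 i + 1 = 0\<close> and \<open>5 i + 2 = 0\<close>, which contradict each other.
\<close>

lemma chain_vanishes:
  fixes f :: "nat \<Rightarrow> 'a::field" and s :: 'a
  assumes nz: "(2::'a) \<noteq> 0" "s \<noteq> 0"
    and r1: "\<And>i. i + 1 \<le> \<sigma> \<Longrightarrow> (of_nat i - 2 * s) * f (i + 1) = (of_nat i + 1 + s) * f i"
    and r2: "\<And>i. i + 2 \<le> \<sigma> \<Longrightarrow> (of_nat i - 3 * s) * f (i + 2) = (of_nat i + 2 + 2 * s) * f i"
    and bd: "f 0 = 0" "f 1 = 0" "f \<sigma> = 0" "f (\<sigma> - 1) = 0"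
    and i: "i \<le> \<sigma>"
  shows "f i = 0"
proof (rule ccontr)
  let ?D = "chain_quadratic s"
  have D: "?D (of_nat i) = 0 \<or> f i = 0 \<and> f (i + 2) = 0" if "i + 2 \<le> \<sigma>" for i
    using r1[of i] r1[of "i + 1"] r2[of i] that
    by (intro chain_quadratic_annihilates[OF nz(2), of _ "f (i + 1)"]) (auto simp: algebra_simps)
  \<comment> \<open>Subtracting the values of the quadratic at \<open>i - 2\<close> and \<open>i\<close> cancels the square and leaves
    a linear equation for \<open>i\<close>.\<close>
  have centre: "of_nat i * 2 = s \<and> i + 2 \<le> \<sigma>" if "f i \<noteq> 0" "i \<le> \<sigma>" for i
  proof -
    have "i \<noteq> 0" "i \<noteq> 1" "i \<noteq> \<sigma>" "i \<noteq> \<sigma> - 1" using that bd by metis+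
    then have le: "i + 2 \<le> \<sigma>" "i - 2 + 2 = i" using that by auto
    define y :: 'a where "y = of_nat (i - 2)"
    have y: "of_nat i = y + 2" unfolding y_def using le(2) by (metis of_nat_add of_nat_numeral)
    have "?D (of_nat i) = 0" "?D y = 0"
      using D[of i] D[of "i - 2"] le that by (auto simp: y_def)
    then have "2 * (2 * (y + 2) - s) = 0"
      unfolding y chain_quadratic_def by (simp add: power2_eq_square algebra_simps) algebra
    then have "2 * (y + 2) = s" using nz(1) by (metis eq_iff_diff_eq_0 mult_eq_0_iff)
    then show ?thesis using le by (simp add: y mult.commute)
  qed
  assume fi: "f i \<noteq> 0"
  then have s: "s = 2 * of_nat i" and le: "i + 2 \<le> \<sigma>" using centre[of i] i by auto
  have "(4::'a) = 2 * 2" by simp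
  then have "(4::'a) \<noteq> 0" using nz(1) by (metis mult_eq_0_iff)
  then have "f (i + 1) = 0" "f (i + 2) = 0"
    using centre[of "i + 1"] centre[of "i + 2"] le nz by (auto simp: s algebra_simps) 
  then have "(3 * of_nat i + 1) * f i = 0" "(5 * of_nat i + 2) * f i = 0"
    using r1[of i] r2[of i] le by (auto simp: s algebra_simps)
  with fi have "3 * of_nat i + 1 = (0::'a)" "5 * of_nat i + 2 = (0::'a)"
    by (metis mult_eq_0_iff)+
  then have "(1::'a) = 0" by algebra
  then show False by simp
qed

text \<open>
  At the ends of a chain the first recursion makes \<open>g0\<close> and \<open>g1\<close> vanish together, while the
  quadratic takes different values at \<open>0\<close> and \<open>1\<close>.
\<close>

lemma chain_boundary:
  fixes s g0 g1 g2 g3 :: "'a::field"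
  assumes "s \<noteq> 0" "s \<noteq> - 1" "s \<noteq> 3" "(2::'a) \<noteq> 0"
    and "- (2 * s) * g1 = (1 + s) * g0"
    and "chain_quadratic s 0 = 0 \<or> g0 = 0" "chain_quadratic s 1 = 0 \<or> g1 = 0"
  shows "g0 = 0 \<and> g1 = 0"
proof -
  have "1 + s \<noteq> 0" using assms(2) by (metis add_eq_0_iff)
  then have iff: "g0 = 0 \<longleftrightarrow> g1 = 0" using assms(1,4,5) by auto
  have "chain_quadratic s 1 - chain_quadratic s 0 = 3 - s" by (simp add: chain_quadratic_def)
  then show ?thesis using assms(3,6,7) iff by auto
qed

text \<open>
  The symmetry \<open>i \<mapsto> \<sigma> - i\<close> of the recursions, which carries the lower end of a chain to the
  upper end.
\<close>

lemma chain_reflect: "chain_quadratic s (s - 2 - x) = chain_quadratic s x"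
  unfolding chain_quadratic_def by algebra

lemma long_chain_vanishes:
  fixes f :: "nat \<Rightarrow> 'a::field"
  assumes p: "CHAR('a) = p" "p \<ge> 5"
    and s: "4 \<le> s" "s + 2 \<le> p"
    and r1: "\<And>i. i + 1 \<le> s \<Longrightarrow> (of_nat i - 2 * of_nat s) * f (i + 1) = (of_nat i + 1 + of_nat s) * f i"
    and r2: "\<And>i. i + 2 \<le> s \<Longrightarrow> (of_nat i - 3 * of_nat s) * f (i + 2) = (of_nat i + 2 + 2 * of_nat s) * f i"
    and i: "i \<le> s"
  shows "f i = 0"
proof -
  let ?s = "of_nat s :: 'a"
  have nz: "?s \<noteq> 0" "?s \<noteq> 3" "(2::'a) \<noteq> 0"
    using of_nat_eq_iff_less_CHAR[where ?'a = 'a, of s 0] of_nat_eq_iff_less_CHAR[where ?'a = 'a, of s 3]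
       of_nat_eq_iff_less_CHAR[where ?'a = 'a, of 2 0] p s by auto
  have s1: "?s \<noteq> - 1"
    using of_nat_eq_0_iff_char_dvd[where ?'a = 'a, of "s + 1"] p s
    by (auto simp: eq_neg_iff_add_eq_0 add.commute dest: dvd_imp_le)
  have D: "chain_quadratic ?s (of_nat i) = 0 \<or> f i = 0 \<and> f (i + 2) = 0" if "i + 2 \<le> s" for i
    using r1[of i] r1[of "i + 1"] r2[of i] that
    by (intro chain_quadratic_annihilates[OF nz(1), of _ "f (i + 1)"]) (auto simp: algebra_simps)
  have lo: "f 0 = 0 \<and> f 1 = 0"
    using D[of 0] D[of 1] r1[of 0] s by (intro chain_boundary[OF nz(1) s1 nz(2,3)]) auto
  have n: "of_nat (s - 2) = ?s - 2 - 0" "of_nat (s - 3) = ?s - 2 - 1" "of_nat (s - 1) = ?s - 1"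
    using s by (auto simp: of_nat_diff)
  have hi: "f s = 0 \<and> f (s - 1) = 0"
  proof (rule chain_boundary[OF nz(1) s1 nz(2,3)])
    show "- (2 * ?s) * f (s - 1) = (1 + ?s) * f s"
      using r1[of "s - 1"] s by (simp add: n(3)) algebra
    have "s - 2 + 2 = s" "s - 3 + 2 = s - 1" using s by auto
    then show "chain_quadratic ?s 0 = 0 \<or> f s = 0" "chain_quadratic ?s 1 = 0 \<or> f (s - 1) = 0"
      using D[of "s - 2"] D[of "s - 3"] s unfolding n chain_reflect by auto
  qed
  show ?thesis
    by (rule chain_vanishes[OF nz(3,1) r1 r2]) (use lo hi i in auto)
qed

text \<open>
  The chains that are too short for the argument at the two ends, with at most four unknowns. For
  \<open>s = 3\<close> the equations imply \<open>28 f(0) = 0\<close>; this is the point where the characteristic 7 is special.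
\<close>

lemma short_chain_vanishes:
  fixes f :: "nat \<Rightarrow> 'a::field"
  assumes p: "CHAR('a) = p" "p \<ge> 5"
    and s: "s = 2 \<or> s = 3"
    and r1: "\<And>i. i + 1 \<le> s \<Longrightarrow> (of_nat i - 2 * of_nat s) * f (i + 1) = (of_nat i + 1 + of_nat s) * f i"
    and r2: "\<And>i. i + 2 \<le> s \<Longrightarrow> (of_nat i - 3 * of_nat s) * f (i + 2) = (of_nat i + 2 + 2 * of_nat s) * f i"
    and exceptional: "s = 3 \<Longrightarrow> p = 7 \<Longrightarrow> f 0 = 0"
    and i: "i \<le> s"
  shows "f i = 0"
proof -
  have char: "(of_nat n :: 'a) = 0 \<longleftrightarrow> p dvd n" for n
    using of_nat_eq_0_iff_char_dvd[where ?'a = 'a] p by simp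
  have small: "(of_nat n :: 'a) \<noteq> 0" if "0 < n" "n < 5" for n
    using that p by (auto simp: char dest: dvd_imp_le)
  have nz: "(2 :: 'a) \<noteq> 0" "(3 :: 'a) \<noteq> 0"
    using small[of 2] small[of 3] by simp_all
  have "(4 :: 'a) = 2 * 2" "(6 :: 'a) = 2 * 3" "(9 :: 'a) = 3 * 3" "(72 :: 'a) = 2 * 2 * 2 * 3 * 3"
    "(28 :: 'a) = 2 * 2 * 7"
    by simp_all
  with nz have nz': "(4 :: 'a) \<noteq> 0" "(6 :: 'a) \<noteq> 0" "(9 :: 'a) \<noteq> 0" "(72 :: 'a) \<noteq> 0"
    "(28 :: 'a) = 0 \<longleftrightarrow> (7 :: 'a) = 0"
    by (metis mult_eq_0_iff)+
  from s show ?thesis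
  proof
    assume s: "s = 2"
    have "- 4 * f 1 = 3 * f 0" "- 3 * f 2 = 4 * f 1" "- 6 * f 2 = 6 * f 0"
      using r1[of 0] r1[of 1] r2[of 0] by (simp_all add: s numeral_2_eq_2)
    then have "72 * f 0 = 0" "4 * f 1 = - (3 * f 0)" "6 * f 2 = - (6 * f 0)"
      by algebra+
    then have "f 0 = 0 \<and> f 1 = 0 \<and> f 2 = 0" using nz' by auto
    moreover have "i = 0 \<or> i = 1 \<or> i = 2" using i s by auto
    ultimately show ?thesis by auto
  next
    assume s: "s = 3"
    have e: "- 6 * f 1 = 4 * f 0" "- 5 * f 2 = 5 * f 1" "- 4 * f 3 = 6 * f 2"
      "- 9 * f 2 = 8 * f 0" "- 8 * f 3 = 9 * f 1"
      using r1[of 0] r1[of 1] r1[of 2] r2[of 0] r2[of 1]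
      by (simp_all add: s numeral_2_eq_2 numeral_3_eq_3 algebra_simps)
    have "f 0 = 0"
    proof (cases "p = 7")
      case True
      then show ?thesis using exceptional s by simp
    next
      case False
      have "72 * f 2 = - 64 * f 0" "54 * f 1 = - 36 * f 0"
        using e(4) e(1) by algebra+
      moreover have "- 24 * f 3 = 36 * f 2" "- 24 * f 3 = 27 * f 1"
        using e(3) e(5) by algebra+
      ultimately have "28 * f 0 = 0"
        by algebra
      moreover have "\<not> p dvd 7"
      proof
        assume "p dvd 7"
        then have "p \<le> 7" by (rule dvd_imp_le) simp
        then have "p = 5 \<or> p = 6" using False p by linarith
        with \<open>p dvd 7\<close> show False by auto
      qed
      then have "(7 :: 'a) \<noteq> 0"
        using char[of 7] by simp
      ultimately show ?thesis using nz' by simp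
    qed
    moreover from this have "f 1 = 0" "f 2 = 0"
      using e(1,4) nz' by auto
    moreover from this have "f 3 = 0"
      using e(3) nz' by auto
    ultimately have "f 0 = 0 \<and> f 1 = 0 \<and> f 2 = 0 \<and> f 3 = 0" by blast
    moreover have "i = 0 \<or> i = 1 \<or> i = 2 \<or> i = 3" using i s by auto
    ultimately show ?thesis by auto
  qed
qed

text \<open>
  Here \<open>b = -s\<close>, and the weight condition allows only \<open>i + j = s\<close> and
  \<open>i + j = s + p\<close>. In the second case the ends of the chain lie outside the index range, so that the boundary
  values vanish for free.
\<close>

lemma form_invariant_under_positive_part_vanishes:
  fixes \<phi> :: "nat \<Rightarrow> nat \<Rightarrow> 'a::field"
  assumes p: "CHAR('a) = p" "p \<ge> 5"
    and s: "2 \<le> s" "s + 2 \<le> p"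
    and outside: "\<And>i j. p \<le> i \<or> p \<le> j \<Longrightarrow> \<phi> i j = 0"
    and weight: "\<And>i j. \<phi> i j \<noteq> 0 \<Longrightarrow> of_nat (i + j) = (of_nat s :: 'a)"
    and inv: "\<And>k i j. k \<ge> 1 \<Longrightarrow> (of_nat i - of_nat s * (of_nat k + 1)) * \<phi> (i + k) j +
                 (of_nat j - of_nat s * (of_nat k + 1)) * \<phi> i (j + k) = 0"
    and exceptional: "s = 3 \<Longrightarrow> p = 7 \<Longrightarrow> \<phi> 0 3 = 0"
  shows "\<phi> i j = 0"
proof (rule ccontr)
  assume nz: "\<phi> i j \<noteq> 0"
  have rel: "(of_nat i - of_nat s * (of_nat k + 1)) * \<phi> (i + k) (\<sigma> - (i + k)) =
         (of_nat i + of_nat k + of_nat s * of_nat k) * \<phi> i (\<sigma> - i)"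
    if "k \<ge> 1" "i + k \<le> \<sigma>" "of_nat \<sigma> = (of_nat s :: 'a)" for i k \<sigma>
  proof -
    have "of_nat (\<sigma> - (i + k)) = (of_nat s - of_nat i - of_nat k :: 'a)"
      using that by (simp add: of_nat_diff)
    moreover have "\<sigma> - (i + k) + k = \<sigma> - i" using that by auto
    ultimately have "(of_nat i - of_nat s * (of_nat k + 1)) * \<phi> (i + k) (\<sigma> - (i + k)) +
        (of_nat s - of_nat i - of_nat k - of_nat s * (of_nat k + 1)) * \<phi> i (\<sigma> - i) = 0"
      using inv[OF that(1), of i "\<sigma> - (i + k)"] by simp
    then show ?thesis by algebra
  qed
  have i: "i < p" and j: "j < p" using nz outside by (meson not_le)+
  have cases: "i + j = s \<or> i + j = s + p"
  proof -
    have "p dvd (if i + j < s then s - (i + j) else i + j - s)"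
      using weight[OF nz] of_nat_eq_iff_char_dvd[where ?'a = 'a, of s "i + j"]
        of_nat_eq_iff_char_dvd[where ?'a = 'a, of "i + j" s] p by (auto simp: not_less le_less)
    then obtain q where q: "(if i + j < s then s - (i + j) else i + j - s) = p * q" by (auto simp: dvd_def)
    moreover have "(if i + j < s then s - (i + j) else i + j - s) < p * 2" using i j s by auto
    ultimately have "q < 2" by simp
    then have "q = 0 \<or> q = 1" by auto
    then show ?thesis using q s by (auto split: if_splits)
  qed
  define \<sigma> f where "\<sigma> = i + j" and "f = (\<lambda>i. \<phi> i (\<sigma> - i))"
  have fi: "f i \<noteq> 0" using nz by (simp add: f_def \<sigma>_def)
  have \<sigma>: "of_nat \<sigma> = (of_nat s :: 'a)" using weight[OF nz] \<sigma>_def by simp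
  have r1: "(of_nat i - 2 * of_nat s) * f (i + 1) = (of_nat i + 1 + of_nat s) * f i" if "i + 1 \<le> \<sigma>" for i
    using rel[of 1 i \<sigma>] that \<sigma> by (simp add: f_def algebra_simps)
  have r2: "(of_nat i - 3 * of_nat s) * f (i + 2) = (of_nat i + 2 + 2 * of_nat s) * f i" if "i + 2 \<le> \<sigma>" for i
    using rel[of 2 i \<sigma>] that \<sigma> by (simp add: f_def algebra_simps)
  have "f i = 0"
  proof (cases "\<sigma> = s")
    case True
    consider "s = 2 \<or> s = 3" | "4 \<le> s" using s by linarith
    then show ?thesis
    proof cases
      case 1
      then show ?thesis
        by (rule short_chain_vanishes[OF p]) (use r1 r2 exceptional True \<sigma>_def in \<open>auto simp: f_def\<close>)
    next
      case 2
      then show ?thesis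
        by (rule long_chain_vanishes[OF p _ s(2)]) (use r1 r2 True \<sigma>_def in auto)
    qed
  next
    case False
    then have \<sigma>': "\<sigma> = s + p" using cases \<sigma>_def by simp
    have "(of_nat 2 :: 'a) \<noteq> 0" "(of_nat s :: 'a) \<noteq> 0"
      using p s by (auto simp del: of_nat_numeral simp: of_nat_eq_0_iff_char_dvd dest: dvd_imp_le)
    then have nz: "(2 :: 'a) \<noteq> 0" "(of_nat s :: 'a) \<noteq> 0"
      by simp_all
    have bd: "f 0 = 0" "f 1 = 0" "f \<sigma> = 0" "f (\<sigma> - 1) = 0"
      unfolding f_def \<sigma>' by (rule outside, use s in linarith)+
    show ?thesis
      by (rule chain_vanishes[OF nz r1 r2 bd]) (simp_all add: \<sigma>_def)
  qed
  with fi show False by simp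
qed


section \<open>Highest weight vectors\<close>

context witt_module begin

lemma act_add [simp]: "act D (u + v) = act D u + act D v"
  and act_scale [simp]: "act D (scale c v) = scale c (act D v)"
  and act_zero [simp]: "act D 0 = 0"
  and act_sum: "act D (sum h A) = (\<Sum>a\<in>A. act D (h a))"
proof -
  interpret module_hom scale scale "act D"
    using linear_act[of D] by (simp add: Vector_Spaces.linear_def)
  show "act D (u + v) = act D u + act D v" "act D (scale c v) = scale c (act D v)" "act D 0 = 0"
    "act D (sum h A) = (\<Sum>a\<in>A. act D (h a))"
    by (fact add scale zero sum)+
qed

lemma act_zero_left [simp]: "act 0 v = 0"
  and act_scale_left: "act (witt_scale c D) v = scale c (act D v)"
  and act_sum_left: "act (sum h A) v = (\<Sum>a\<in>A. act (h a) v)"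
proof -
  interpret module_hom witt_scale scale "\<lambda>D. act D v"
    using linear_rep[of v] by (simp add: Vector_Spaces.linear_def)
  show "act (witt_scale c D) v = scale c (act D v)" "act 0 v = 0" "act (sum h A) v = (\<Sum>a\<in>A. act (h a) v)"
    by (fact scale zero sum)+
qed

lemma act_expansion:
  "act D v = (\<Sum>k\<in>{-1..int CHAR('a) - 2}. scale (witt_coeff D k) (act (witt_e k) v))"
  by (subst witt_expansion[of D]) (simp add: act_sum_left act_scale_left)

lemma act_e_commute:
  assumes "i \<ge> -1" "j \<ge> -1"
  shows "act (witt_e i) (act (witt_e j) v) =
    act (witt_e j) (act (witt_e i) v) + scale (of_int (j - i)) (act (witt_e (i + j)) v)"
  using act_bracket[of "witt_e i" "witt_e j" v]
  unfolding witt_bracket_e[OF assms, where ?'a = 'a] act_scale_left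
  by (simp add: algebra_simps)

lemma subspace_invariantI:
  assumes "subspace U" "\<And>k u. -1 \<le> k \<Longrightarrow> u \<in> U \<Longrightarrow> act (witt_e k) u \<in> U" "u \<in> U"
  shows "act D u \<in> U"
  unfolding act_expansion[of D u] using assms by (intro subspace_sum subspace_scale) auto

lemma span_invariantI:
  assumes "\<And>k x. -1 \<le> k \<Longrightarrow> x \<in> S \<Longrightarrow> act (witt_e k) x \<in> span S" "u \<in> span S"
  shows "act D u \<in> span S"
proof (rule subspace_invariantI)
  fix k :: int and u assume k: "-1 \<le> k" and "u \<in> span S"
  from this(2) show "act (witt_e k) u \<in> span S"
    by (induction rule: span_induct_alt) (auto simp: span_zero intro!: span_add span_scale assms(1)[OF k])
qed (use assms in auto)

end

lemma kernel_of_nilpotent: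
  fixes T :: "'b::zero \<Rightarrow> 'b"
  assumes "\<And>v. v \<in> K \<Longrightarrow> T v \<in> K"
  shows "(T ^^ n) u = 0 \<Longrightarrow> u \<in> K \<Longrightarrow> u \<noteq> 0 \<Longrightarrow> \<exists>w\<in>K. w \<noteq> 0 \<and> T w = 0"
proof (induction n arbitrary: u)
  case (Suc n)
  then show ?case
    using Suc.IH[of "T u"] assms[of u] by (cases "T u = 0") (auto simp: funpow_swap1)
qed simp

text \<open>
  Both sides are monic of degree \<open>p\<close> and vanish on the prime field by Fermat's little theorem.
\<close>

lemma prod_prime_field:
  assumes p: "CHAR('a::field) = p" "p > 0"
  shows "(\<Prod>a<p. [:- of_nat a, 1:]) = (monom 1 p - monom 1 1 :: 'a poly)"
proof (rule poly_eqI_degree_lead_coeff)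
  let ?P = "\<Prod>a<p. [:- of_nat a, 1:] :: 'a poly" and ?A = "of_nat ` {..<p} :: 'a set"
  have prime: "prime p" using prime_CHAR_semidom[where ?'a = 'a] p by auto
  then have p1: "1 < p" by (rule prime_gt_1_nat)
  have deg: "degree ?P = p" by (subst degree_prod_eq_sum_degree) auto
  then show "degree ?P \<le> p" by simp
  have "lead_coeff ?P = 1" by (simp add: lead_coeff_prod)
  with deg p1 show "coeff ?P p = coeff (monom 1 p - monom 1 1) p" by simp
  show "degree (monom 1 p - monom 1 1 :: 'a poly) \<le> p"
    using p1 by (intro degree_diff_le) (auto simp: degree_monom_eq)
  have "inj_on (of_nat :: nat \<Rightarrow> 'a) {..<p}"
    using p by (auto simp: inj_on_def of_nat_eq_iff_less_CHAR)
  then show "p \<le> card ?A" by (simp add: card_image)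
  have fermat: "(of_nat n :: 'a) ^ p = of_nat n" for n
    using prime p by (induction n) (simp_all add: freshmans_dream)
  fix z :: 'a assume "z \<in> ?A"
  then obtain n where n: "z = of_nat n" "n < p" by auto
  then show "poly ?P z = poly (monom 1 p - monom 1 1) z"
    using prod_zero[of "{..<p}" "\<lambda>a. z - of_nat a"] by (auto simp: poly_prod poly_monom fermat)
qed

context vector_space begin

text \<open>
  The product of the commuting operators \<open>T - a\<close> over all \<open>a\<close> in the prime field is
  \<open>T\<^sup>p - T\<close> and annihilates \<open>w\<close>. Hence one of the factors annihilates a nonzero vector obtained from
  \<open>w\<close> by the previous factors.
\<close>

lemma prime_field_eigenvector:
  assumes p: "CHAR('a) = p" "p > 0"
    and T: "Vector_Spaces.linear scale scale T" and K: "subspace K" "\<And>v. v \<in> K \<Longrightarrow> T v \<in> K"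
    and w: "w \<in> K" "w \<noteq> 0" "(T ^^ p) w = T w"
  obtains \<mu> v where "v \<in> K" "v \<noteq> 0" "T v = scale (of_nat \<mu>) v"
proof -
  interpret T: module_hom scale scale T
    using T by (simp add: Vector_Spaces.linear_def)
  \<comment> \<open>\<open>S n\<close> is the product of \<open>T - a\<close> over \<open>a < n\<close>, applied to \<open>w\<close>.\<close>
  define S where "S = rec_nat w (\<lambda>n v. T v - scale (of_nat n) v)"
  have S: "S 0 = w" "S (Suc n) = T (S n) - scale (of_nat n) (S n)" for n
    by (simp_all add: S_def)
  define P where "P n = (\<Prod>a<n. [:- of_nat a, 1:] :: 'a poly)" for n
  have deg: "degree (P n) = n" for n
    unfolding P_def by (subst degree_prod_eq_sum_degree) auto
  have "S n = (\<Sum>i\<le>n. scale (coeff (P n) i) ((T ^^ i) w))" for n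
  proof (induction n)
    case 0
    then show ?case by (simp add: S P_def)
  next
    case (Suc n)
    let ?t = "\<lambda>i. (T ^^ i) w"
    have P: "P (Suc n) = pCons 0 (P n) - smult (of_nat n) (P n)"
      by (simp add: P_def mult.commute)
    have "coeff (P n) (Suc n) = 0" by (simp add: coeff_eq_0 deg)
    then have "(\<Sum>i\<le>Suc n. scale (coeff (P (Suc n)) i) (?t i)) =
        (\<Sum>i\<le>Suc n. scale (coeff (pCons 0 (P n)) i) (?t i)) - (\<Sum>i\<le>n. scale (of_nat n * coeff (P n) i) (?t i))"
      by (simp add: P scale_left_diff_distrib sum_subtractf)
    also have "(\<Sum>i\<le>Suc n. scale (coeff (pCons 0 (P n)) i) (?t i)) = T (S n)"
      unfolding Suc.IH by (subst sum.atMost_Suc_shift) (simp add: T.sum T.scale)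
    also have "(\<Sum>i\<le>n. scale (of_nat n * coeff (P n) i) (?t i)) = scale (of_nat n) (S n)"
      unfolding Suc.IH by (simp add: scale_sum_right)
    finally show ?case by (simp add: S)
  qed
  then have "S p = (\<Sum>i\<le>p. scale (coeff (monom 1 p - monom 1 1) i) ((T ^^ i) w))"
    using prod_prime_field[OF p] by (simp add: P_def)
  also have "\<dots> = (\<Sum>i\<le>p. if i = p then (T ^^ i) w else 0) - (\<Sum>i\<le>p. if i = 1 then (T ^^ i) w else 0)"
    unfolding sum_subtractf[symmetric] by (intro sum.cong) (auto simp: scale_left_diff_distrib)
  also have "\<dots> = 0"
    using w(3) p by simp
  finally have Sp: "S p = 0" .
  define n where "n = (LEAST n. S n = 0)"
  have "S n = 0" unfolding n_def using Sp by (rule LeastI)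
  then obtain k where k: "n = Suc k" using w(2) S(1) by (cases n) auto
  have "S k \<noteq> 0" using not_less_Least[of k "\<lambda>n. S n = 0"] k by (simp add: n_def)
  moreover have "S j \<in> K" for j
  proof (induction j)
    case (Suc j)
    then show ?case unfolding S by (intro subspace_diff subspace_scale K)
  qed (simp add: S w)
  moreover have "T (S k) = scale (of_nat k) (S k)"
    using \<open>S n = 0\<close> S(2)[of k] k by simp
  ultimately show ?thesis using that[of "S k" k] by simp
qed

end

text \<open>
  Each \<open>e\<^sub>k\<close> with \<open>k \<ge> 1\<close> is nilpotent because its \<open>p\<close>-th power is zero, and it preserves
  the common kernel of the \<open>e\<^sub>j\<close> with \<open>j > k\<close>. So the common kernel of all \<open>e\<^sub>j\<close> with \<open>j \<ge> k\<close> stays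
  nonzero when \<open>k\<close> decreases to \<open>1\<close>, and \<open>e\<^sub>0\<close>, which satisfies \<open>e\<^sub>0\<^sup>p = e\<^sub>0\<close>, has an
  eigenvector in it.
\<close>

lemma (in witt_module) exists_highest_weight_vector:
  fixes u :: 'v
  assumes res: "witt_restricted act" and p: "CHAR('a) \<ge> 5" and u: "u \<noteq> 0"
  obtains w \<mu> where "w \<noteq> 0" "\<And>k. k \<ge> 1 \<Longrightarrow> act (witt_e k) w = 0" "act (witt_e 0) w = scale (of_nat \<mu>) w"
proof -
  let ?p = "CHAR('a)"
  define K where "K n = {w. \<forall>k\<ge>n. act (witt_e k) w = 0}" for n :: int
  have pow: "(act (witt_e k) ^^ ?p) w = act (if k = 0 then witt_e k else 0) w" for k w
  proof -
    have "act (witt_pmap (witt_e k)) = act (witt_e k) ^^ ?p" using res by (simp add: witt_restricted_def)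
    then show ?thesis using p by (simp add: witt_pmap_e)
  qed
  have stable: "act (witt_e n) w \<in> K (n + d)" if "w \<in> K (n + d)" "0 \<le> n" "0 \<le> d" for n d w
    using that act_e_commute[of _ n w] by (auto simp: K_def)
  have "n \<ge> 1 \<Longrightarrow> \<exists>w\<in>K n. w \<noteq> 0" if "n \<le> int ?p" for n
    using that
  proof (induction rule: int_le_induct)
    case base
    have "act (witt_e k) u = 0" if "k \<ge> int ?p" for k
      using that witt_e_eq_0[where ?'a = 'a, of k] by simp
    then show ?case using u by (auto simp: K_def)
  next
    case (step n)
    then obtain u where u: "u \<in> K n" "u \<noteq> 0" by auto
    have "(act (witt_e (n - 1)) ^^ ?p) u = 0" using pow step by simp
    moreover have "act (witt_e (n - 1)) v \<in> K n" if "v \<in> K n" for v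
      using stable[of v "n - 1" 1] that step by simp
    ultimately obtain w where w: "w \<in> K n" "w \<noteq> 0" "act (witt_e (n - 1)) w = 0"
      using kernel_of_nilpotent[of "K n" "act (witt_e (n - 1))" ?p u] u by blast
    have "act (witt_e k) w = 0" if "k \<ge> n - 1" for k
      using that w by (cases "k = n - 1") (auto simp: K_def)
    with w(2) show ?case by (auto simp: K_def)
  qed
  from this[of 1] obtain u where u: "u \<in> K 1" "u \<noteq> 0" using p by auto
  note result = that
  show ?thesis
  proof (rule prime_field_eigenvector[of ?p "act (witt_e 0)" "K 1" u])
    show "subspace (K 1)" by (auto simp: K_def subspace_def)
    show "act (witt_e 0) v \<in> K 1" if "v \<in> K 1" for v using stable[of v 0 1] that by simp
    show "thesis" if "v \<in> K 1" "v \<noteq> 0" "act (witt_e 0) v = scale (of_nat \<mu>) v" for \<mu> v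
      using that result[of v \<mu>] by (simp add: K_def)
  qed (use u p pow linear_act in auto)
qed


section \<open>Restricted irreducible modules as quotients of tensor density modules\<close>

text \<open>
  A quotient of the tensor density module of parameter \<open>b\<close>, where \<open>m i\<close> is the image of
  \<open>x\<^sup>i (dx)\<^sup>b\<close>; some \<open>m i\<close> may be zero. For \<open>i = 0\<close> the relation \<open>lower\<close> says that \<open>m 0\<close> is
  killed by \<open>e\<^sub>-\<^sub>1\<close>, because its coefficient is zero.
\<close>

locale density_module = witt_module scale act
  for scale :: "'a::field \<Rightarrow> 'v::ab_group_add \<Rightarrow> 'v" and act :: "'a witt \<Rightarrow> 'v \<Rightarrow> 'v" +
  fixes b :: 'a and m :: "nat \<Rightarrow> 'v"
  assumes lower: "act (witt_e (-1)) (m i) = scale (of_nat i) (m (i - 1))"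
    and raise: "act (witt_e (int k)) (m i) = scale (of_nat i + b * (of_nat k + 1)) (m (i + k))"
    and m_beyond: "CHAR('a) \<le> i \<Longrightarrow> m i = 0"
    and span_m: "span (range m) = UNIV"

text \<open>
  The vector \<open>m (p - 1)\<close> is a highest weight vector of weight \<open>\<mu> = b - 1\<close>, and the others are
  defined by \<open>e\<^sub>-\<^sub>1 m\<^sub>i = i m\<^sub>i\<^sub>-\<^sub>1\<close>. At \<open>i = 0\<close> this relation holds because \<open>e\<^sub>-\<^sub>1\<close> has
  \<open>p\<close>-th power zero. The action of the remaining \<open>e\<^sub>k\<close> follows by descending induction on
  \<open>i\<close> from the commutator of \<open>e\<^sub>k\<close> and \<open>e\<^sub>-\<^sub>1\<close>, and the span is everything by irreducibility.
\<close>

lemma (in witt_module) restricted_irreducible_is_density_module: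
  assumes res: "witt_restricted act" and irr: "witt_irreducible scale act" and p: "CHAR('a) \<ge> 5"
  obtains n m where "density_module scale act (of_nat n) m" "m (CHAR('a) - 1) \<noteq> 0"
proof -
  let ?p = "CHAR('a)"
  obtain u :: 'v where u: "u \<noteq> 0" using irr unfolding witt_irreducible_def by blast
  obtain w \<mu>
    where w: "w \<noteq> 0" "\<And>k. k \<ge> 1 \<Longrightarrow> act (witt_e k) w = 0" "act (witt_e 0) w = scale (of_nat \<mu>) w"
    using exists_highest_weight_vector[OF res p u] by metis
  \<comment> \<open>\<open>v n\<close> will be \<open>m (p - 1 - n)\<close>; counting from the top makes the definition recursive.\<close>
  define v where "v = rec_nat w (\<lambda>n v. scale (inverse (of_nat (?p - 1 - n))) (act (witt_e (-1)) v))"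
  have v: "v 0 = w" "v (Suc n) = scale (inverse (of_nat (?p - 1 - n))) (act (witt_e (-1)) (v n))" for n
    by (simp_all add: v_def)
  define m where "m i = (if i < ?p then v (?p - 1 - i) else 0)" for i
  \<comment> \<open>The weight of \<open>m (p - 1)\<close> is \<open>p - 1 + b\<close>.\<close>
  define b :: 'a where "b = of_nat (Suc \<mu>)"
  have nz: "(of_nat i :: 'a) \<noteq> 0" if "0 < i" "i < ?p" for i
    using that by (auto simp: of_nat_eq_0_iff_char_dvd dest: dvd_imp_le)
  have top: "m (?p - 1) = w" using p by (simp add: m_def v)
  have v_pow: "\<exists>c. v n = scale c ((act (witt_e (-1)) ^^ n) w)" for n
  proof (induction n)
    case 0
    show ?case by (rule exI[of _ 1]) (simp add: v)
  next
    case (Suc n)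
    then show ?case by (auto simp: v)
  qed
  have low: "act (witt_e (-1)) (m i) = scale (of_nat i) (m (i - 1))" for i
  proof -
    consider "?p < i" | "i = ?p" | "0 < i" "i < ?p" | "i = 0" by linarith
    then show ?thesis
    proof cases
      case 3
      then have "?p - 1 - (i - 1) = Suc (?p - 1 - i)" "?p - 1 - (?p - 1 - i) = i" "i - 1 < ?p" by auto
      with 3 nz[of i] show ?thesis by (simp add: m_def v)
    next
      case 4
      obtain c where "v (?p - 1) = scale c ((act (witt_e (-1)) ^^ (?p - 1)) w)" using v_pow by blast
      then have "act (witt_e (-1)) (m i) = scale c (act (witt_e (-1)) ((act (witt_e (-1)) ^^ (?p - 1)) w))"
        using p 4 by (simp add: m_def)
      also have "\<dots> = scale c ((act (witt_e (-1)) ^^ Suc (?p - 1)) w)"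
        by (simp only: funpow.simps o_apply)
      also have "Suc (?p - 1) = ?p" using p by simp
      also have "act (witt_e (-1)) ^^ ?p = act (witt_pmap (witt_e (-1)))"
        using res by (simp add: witt_restricted_def)
      also have "witt_pmap (witt_e (-1)) = (0 :: 'a witt)" using p witt_pmap_e[where ?'a = 'a and i = "-1"] by simp
      finally show ?thesis using 4 by simp
    qed (auto simp: m_def)
  qed
  have raise_top: "act (witt_e (int k)) (m (?p - 1)) = scale (of_nat (?p - 1) + b * (of_nat k + 1)) (m (?p - 1 + k))" for k
  proof (cases "k = 0")
    case True
    have "of_nat (?p - 1) + b = of_nat (?p + \<mu>)" using p unfolding b_def of_nat_add[symmetric]
      by (intro arg_cong[of _ _ of_nat]) simp
    then show ?thesis using True w(3) top by simp
  next
    case False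
    then have "\<not> ?p - 1 + k < ?p" by linarith
    then have "m (?p - 1 + k) = 0" by (simp add: m_def)
    then show ?thesis using False w(2) top by simp
  qed
  have "\<forall>k. act (witt_e (int k)) (m i) = scale (of_nat i + b * (of_nat k + 1)) (m (i + k))" if "i \<le> ?p - 1" for i
    using that
  proof (induction rule: inc_induct)
    case base
    show ?case using raise_top by blast
  next
    case (step i)
    have i: "(of_nat (Suc i) :: 'a) \<noteq> 0" using step.hyps by (intro nz) auto
    have e: "m i = scale (inverse (of_nat (Suc i))) (act (witt_e (-1)) (m (Suc i)))"
      using low[of "Suc i"] i by simp
    have "act (witt_e (int k)) (act (witt_e (-1)) (m (Suc i))) =
        scale (of_nat (Suc i) * (of_nat i + b * (of_nat k + 1))) (m (i + k))" for k
    proof -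
      let ?c = "of_nat (Suc i) + b * (of_nat k + 1)"
      have minus_one: "scale (- 1 - of_nat k) x = - scale (of_nat k + 1) x" for x
        by (simp flip: scale_minus_left)
      have "act (witt_e (int k)) (act (witt_e (-1)) (m (Suc i))) =
         scale (?c * of_nat (Suc i + k)) (m (i + k)) - scale (of_nat k + 1) (act (witt_e (int k - 1)) (m (Suc i)))"
        by (subst act_e_commute) (simp_all add: step.IH low minus_one del: of_nat_Suc)
      also have "scale (of_nat k + 1) (act (witt_e (int k - 1)) (m (Suc i))) =
          scale ((of_nat k + 1) * (of_nat (Suc i) + b * of_nat k)) (m (i + k))"
      proof (cases k)
        case 0
        then show ?thesis by (simp add: low)
      next
        case (Suc l)
        then show ?thesis using step.IH by (simp add: add.commute)
      qed
      also have "scale (?c * of_nat (Suc i + k)) (m (i + k)) - \<dots> =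
         scale (of_nat (Suc i) * (of_nat i + b * (of_nat k + 1))) (m (i + k))"
        unfolding scale_left_diff_distrib[symmetric]
        by (rule arg_cong[where f = "\<lambda>c. scale c (m (i + k))"]) (simp add: algebra_simps)
      finally show ?thesis .
    qed
    then have "act (witt_e (int k)) (m i) = scale (of_nat i + b * (of_nat k + 1)) (m (i + k))" for k
      using i by (subst e) simp
    then show ?case by blast
  qed
  then have ra: "act (witt_e (int k)) (m i) = scale (of_nat i + b * (of_nat k + 1)) (m (i + k))" for i k
    by (cases "i \<le> ?p - 1") (auto simp: m_def)
  have "act D u \<in> span (range m)" if "u \<in> span (range m)" for D u
  proof (rule span_invariantI[OF _ that])
    fix k :: int and x assume k: "-1 \<le> k" and "x \<in> range m"
    then obtain i where x: "x = m i" by blast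
    show "act (witt_e k) x \<in> span (range m)"
    proof (cases "k = -1")
      case True
      then show ?thesis by (simp add: x low span_scale span_base)
    next
      case False
      then have "k = int (nat k)" using k by simp
      then show ?thesis using ra[of "nat k" i] by (simp add: x span_scale span_base)
    qed
  qed
  then have "span (range m) = {0} \<or> span (range m) = UNIV"
    using irr unfolding witt_irreducible_def by (simp add: subspace_span)
  moreover have "w \<in> span (range m)" using top by (metis span_base rangeI)
  ultimately have "span (range m) = UNIV" using w(1) by auto
  then have "density_module scale act (of_nat (Suc \<mu>)) m"
    by unfold_locales (use low ra in \<open>auto simp: b_def m_def\<close>)
  with that top w(1) show thesis by blast
qed

lemma (in vector_space) subspace_scale_cancel:
  assumes "subspace U" "scale c v \<in> U" "c \<noteq> 0"
  shows "v \<in> U"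
  using subspace_scale[OF assms(1,2), of "inverse c"] assms(3) by simp

context density_module begin

lemma sum_range: "\<exists>c. v = (\<Sum>i<CHAR('a). scale (c i) (m i))" if p: "CHAR('a) > 0"
proof -
  have "v \<in> span (range m)" using span_m by simp
  also have "span (range m) \<subseteq> span (m ` {..<CHAR('a)})"
  proof (intro span_minimal subspace_span image_subsetI)
    show "m i \<in> span (m ` {..<CHAR('a)})" for i
      using m_beyond[of i] by (cases "i < CHAR('a)") (auto intro: span_base span_zero)
  qed
  finally show ?thesis
  proof (induction rule: span_induct_alt)
    case base
    show ?case by (rule exI[of _ "\<lambda>_. 0"]) simp
  next
    case (step a x y)
    then obtain c j where c: "y = (\<Sum>i<CHAR('a). scale (c i) (m i))" and j: "x = m j" "j < CHAR('a)" by auto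
    have "scale a x = (\<Sum>i<CHAR('a). scale (if i = j then a else 0) (m i))"
      using j by (simp add: if_distrib[of "\<lambda>c. scale c _"] cong: if_cong)
    then have "scale a x + y = (\<Sum>i<CHAR('a). scale ((if i = j then a else 0) + c i) (m i))"
      by (simp only: c scale_left_distrib sum.distrib)
    then show ?case by (intro exI[of _ "\<lambda>i. (if i = j then a else 0) + c i"])
  qed
qed

text \<open>
  The \<open>m i\<close> are eigenvectors of \<open>e\<^sub>0\<close> for the distinct eigenvalues \<open>i + b\<close>.
\<close>

lemma coefficients_unique:
  assumes "(\<Sum>i<n. scale (c i) (m i)) = 0" "n \<le> CHAR('a)" "i < n" "m i \<noteq> 0"
  shows "c i = 0"
  using assms
proof (induction n arbitrary: c i)
  case (Suc n)
  let ?s = "\<Sum>i<Suc n. scale (c i) (m i)"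
  have small: "c i = 0" if "i < n" "m i \<noteq> 0" for i
  proof -
    have e0: "act (witt_e 0) (m i) = scale (of_nat i + b) (m i)" for i
      using raise[of 0 i] by simp
    have "(\<Sum>i<n. scale (c i * (of_nat i - of_nat n)) (m i)) = act (witt_e 0) ?s - scale (of_nat n + b) ?s"
      by (simp add: act_sum e0 scale_right_distrib scale_sum_right algebra_simps
          flip: sum_subtractf scale_left_diff_distrib)
    also have "\<dots> = 0" unfolding Suc.prems(1) by simp
    finally have "c i * (of_nat i - of_nat n) = 0"
      using that Suc.prems by (intro Suc.IH[of "\<lambda>i. c i * (of_nat i - of_nat n)"]) simp_all
    moreover have "(of_nat i :: 'a) \<noteq> of_nat n"
      using that Suc.prems by (simp add: of_nat_eq_iff_less_CHAR)
    ultimately show ?thesis by simp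
  qed
  then have "(\<Sum>i<n. scale (c i) (m i)) = 0"
    by (intro sum.neutral) (metis lessThan_iff scale_eq_0_iff)
  then show ?case using Suc.prems small[of i] by (cases "i = n") simp_all
qed simp

lemma linear_extension:
  assumes "vector_space s2"
  shows "\<exists>g. Vector_Spaces.linear scale s2 g \<and> (\<forall>i. m i \<noteq> 0 \<longrightarrow> g (m i) = f i)"
proof -
  interpret W: vector_space s2 by fact
  interpret vector_space_pair scale s2 ..
  define I where "I = {i. i < CHAR('a) \<and> m i \<noteq> 0}"
  have I: "i \<in> I" if "m i \<noteq> 0" for i using that m_beyond[of i] by (auto simp: I_def not_le[symmetric])
  have inj: "inj_on m I"
  proof (rule inj_onI, rule ccontr)
    fix i j assume ij: "i \<in> I" "j \<in> I" "m i = m j" "i \<noteq> j"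
    define c where "c k = (if k = i then 1 else if k = j then -1 else 0 :: 'a)" for k
    have "(\<Sum>k<CHAR('a). scale (c k) (m k)) = (\<Sum>k\<in>{i, j}. scale (c k) (m k))"
      using ij by (intro sum.mono_neutral_right) (auto simp: I_def c_def)
    also have "\<dots> = 0" using ij by (simp add: c_def)
    finally show False using coefficients_unique[of c "CHAR('a)" i] ij by (simp add: I_def c_def)
  qed
  have "independent (m ` I)"
  proof -
    have "u (m j) = 0" if sum: "(\<Sum>v\<in>m ` I. scale (u v) v) = 0" and j: "j \<in> I" for u j
    proof -
      define c where "c i = (if i \<in> I then u (m i) else 0)" for i
      have "(\<Sum>i<CHAR('a). scale (c i) (m i)) = (\<Sum>i\<in>I. scale (u (m i)) (m i))"
        by (intro sum.mono_neutral_cong_right) (auto simp: I_def c_def)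
      then have "(\<Sum>i<CHAR('a). scale (c i) (m i)) = 0"
        using sum inj by (simp add: sum.reindex)
      from coefficients_unique[OF this order_refl, of j] j show ?thesis by (simp add: I_def c_def)
    qed
    moreover have "finite (m ` I)" by (simp add: I_def)
    ultimately show ?thesis by (auto simp: dependent_finite)
  qed
  from linear_independent_extend[OF this, of "\<lambda>x. f (inv_into I m x)"]
  obtain g where g: "Vector_Spaces.linear scale s2 g" "\<forall>x\<in>m ` I. g x = f (inv_into I m x)" by blast
  show ?thesis by (rule exI[of _ g]) (use g I inj in auto)
qed

lemma m_nonzero_upwards:
  assumes "m i \<noteq> 0" "i \<le> j" "j < CHAR('a)"
  shows "m j \<noteq> 0"
  using assms(2,3)
proof (induction rule: dec_induct)
  case (step n)
  then have "(of_nat (Suc n) :: 'a) \<noteq> 0"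
    by (auto simp del: of_nat_Suc simp: of_nat_eq_0_iff_char_dvd dest: dvd_imp_le)
  then show ?case using step lower[of "Suc n"] by (auto simp del: of_nat_Suc)
qed (use assms in simp)

text \<open>
  The operator \<open>e\<^sub>-\<^sub>1\<close> lowers degrees, so every nonzero submodule contains \<open>m 0\<close>. From there
  \<open>e\<^sub>k m\<^sub>0 = b (k + 1) m\<^sub>k\<close> reaches every vector but the top one, and
  \<open>e\<^sub>1 m\<^sub>p\<^sub>-\<^sub>2 = 2 (b - 1) m\<^sub>p\<^sub>-\<^sub>1\<close> reaches that one.
\<close>

lemma irreducible:
  assumes p: "CHAR('a) \<ge> 5" and b: "b \<noteq> 0" "b \<noteq> 1" and m0: "m 0 \<noteq> 0"
  shows "witt_irreducible scale act"
  unfolding witt_irreducible_def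
proof (intro conjI allI impI)
  show "UNIV \<noteq> {0 :: 'v}" using m0 by blast
  fix U assume "subspace U \<and> (\<forall>D. \<forall>u\<in>U. act D u \<in> U)"
  then have U: "subspace U" and inv: "\<And>D u. u \<in> U \<Longrightarrow> act D u \<in> U" by auto
  have bottom: "m 0 \<in> U" if "n < CHAR('a)" "(\<Sum>i<Suc n. scale (c i) (m i)) \<in> U" 
    "(\<Sum>i<Suc n. scale (c i) (m i)) \<noteq> 0" for n c
    using that
  proof (induction n arbitrary: c)
    case 0
    then show ?case using subspace_scale_cancel[OF U, of "c 0" "m 0"] by simp
  next
    case (Suc n)
    \<comment> \<open>Applying \<open>e\<^sub>-\<^sub>1\<close> lowers the degree by one; if the result is zero, the vector is a multiple of \<open>m 0\<close>.\<close>
    let ?s = "\<Sum>i<Suc (Suc n). scale (c i) (m i)" and ?d = "\<lambda>i. c (Suc i) * of_nat (Suc i)"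
    have d: "act (witt_e (-1)) ?s = (\<Sum>i<Suc n. scale (?d i) (m i))"
      by (subst sum.lessThan_Suc_shift) (simp add: act_sum lower del: sum.lessThan_Suc of_nat_Suc)
    show ?case
    proof (cases "(\<Sum>i<Suc n. scale (?d i) (m i)) = 0")
      case True
      have "c (Suc i) = 0" if "i < Suc n" for i
      proof -
        have "?d i = 0"
          using that Suc.prems(1) m_nonzero_upwards[OF m0, of i] by (intro coefficients_unique[OF True]) auto
        moreover have "(of_nat (Suc i) :: 'a) \<noteq> 0"
          using that Suc.prems(1) by (auto simp del: of_nat_Suc simp: of_nat_eq_0_iff_char_dvd dest: dvd_imp_le)
        ultimately show ?thesis by simp
      qed
      then have "?s = scale (c 0) (m 0)" by (subst sum.lessThan_Suc_shift) simp
      then show ?thesis using Suc.prems subspace_scale_cancel[OF U, of "c 0" "m 0"] by simp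
    next
      case False
      have "(\<Sum>i<Suc n. scale (?d i) (m i)) \<in> U" using inv[OF Suc.prems(2), of "witt_e (-1)"] unfolding d .
      then show ?thesis using False Suc.prems(1) by (intro Suc.IH[of ?d]) auto
    qed
  qed
  show "U = {0} \<or> U = UNIV"
  proof (rule disjCI)
    assume "U \<noteq> UNIV"
    have False if "u \<in> U" "u \<noteq> 0" for u
    proof -
      obtain c where "u = (\<Sum>i<Suc (CHAR('a) - 1). scale (c i) (m i))" using sum_range[of u] p by auto
      with bottom[of "CHAR('a) - 1" c] that p have m0U: "m 0 \<in> U" by auto
      have mid: "m k \<in> U" if "k < CHAR('a) - 1" for k
      proof -
        have "(of_nat (k + 1) :: 'a) \<noteq> 0"
          using that by (auto simp del: of_nat_Suc of_nat_add simp: of_nat_eq_0_iff_char_dvd dest: dvd_imp_le)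
        then have "b * (of_nat k + 1) \<noteq> 0" using b by (simp add: add.commute)
        moreover have "scale (b * (of_nat k + 1)) (m k) \<in> U"
          using inv[OF m0U, of "witt_e (int k)"] raise[of k 0] by simp
        ultimately show ?thesis using subspace_scale_cancel[OF U] by blast
      qed
      define q where "q = CHAR('a) - 2"
      then have q: "CHAR('a) = Suc (Suc q)" using p by simp
      have "(of_nat q :: 'a) = - 2"
        using of_nat_CHAR[where ?'a = 'a] unfolding q by (simp add: eq_neg_iff_add_eq_0 add.commute)
      then have "of_nat q + b * (of_nat 1 + 1) = 2 * (b - 1)" by (simp add: algebra_simps)
      then have "scale (2 * (b - 1)) (m (Suc q)) \<in> U"
        using inv[OF mid[of q], of "witt_e 1"] raise[of 1 q] q by (simp add: mult.commute)
      moreover have "2 * (b - 1) \<noteq> 0"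
      proof -
        have "(of_nat 2 :: 'a) \<noteq> 0"
          using p by (auto simp del: of_nat_numeral simp: of_nat_eq_0_iff_char_dvd dest: dvd_imp_le)
        then show ?thesis using b by simp
      qed
      ultimately have "m (Suc q) \<in> U" using subspace_scale_cancel[OF U] by blast
      then have "m k \<in> U" for k
        using mid[of k] m_beyond[of k] subspace_0[OF U] q
        by (cases "k < Suc q"; cases "k = Suc q") auto
      then have "span (range m) \<subseteq> U" using U by (intro span_minimal) auto
      with span_m \<open>U \<noteq> UNIV\<close> show False by auto
    qed
    then show "U = {0}" using subspace_0[OF U] by blast
  qed
qed

end

text \<open>
  The linear map \<open>m1 i \<mapsto> m2 i\<close> commutes with the action. It is onto because the \<open>m2 i\<close> span, and its
  kernel is a proper submodule of an irreducible module.
\<close>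

lemma density_modules_isomorphic:
  assumes "density_module s1 a1 b m1" and "density_module s2 a2 b m2"
    and irr: "witt_irreducible s1 a1" and nz: "m1 0 \<noteq> 0" "m2 0 \<noteq> 0"
  obtains \<phi> where "witt_module_iso s1 a1 s2 a2 \<phi>" "\<And>i. \<phi> (m1 i) = m2 i"
proof -
  interpret V: density_module s1 a1 b m1 by fact
  interpret W: density_module s2 a2 b m2 by fact
  from V.linear_extension[OF W.vector_space_axioms, of m2]
  obtain g where "Vector_Spaces.linear s1 s2 g \<and> (\<forall>i. m1 i \<noteq> 0 \<longrightarrow> g (m1 i) = m2 i)" ..
  then have lin: "Vector_Spaces.linear s1 s2 g" and g0: "\<And>i. m1 i \<noteq> 0 \<Longrightarrow> g (m1 i) = m2 i"
    by simp_all
  interpret g: module_hom s1 s2 g using lin by (simp add: Vector_Spaces.linear_def)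
  have g: "g (m1 i) = m2 i" for i
    using g0[of i] V.m_nonzero_upwards[OF nz(1), of i] V.m_beyond[of i] W.m_beyond[of i] by (cases "m1 i = 0") force+
  have hom: "g (a1 D v) = a2 D (g v)" for D v
  proof -
    have e: "g (a1 (witt_e k) (m1 i)) = a2 (witt_e k) (m2 i)" if "-1 \<le> k" for k i
    proof (cases "k = -1")
      case True
      then show ?thesis by (simp add: V.lower W.lower g.scale g)
    next
      case False
      then have k: "k = int (nat k)" using that by simp
      show ?thesis by (subst (1 2) k) (simp only: V.raise W.raise g.scale g)
    qed
    have "v \<in> V.span (range m1)" by (simp add: V.span_m)
    then show ?thesis
    proof (induction rule: V.span_induct_alt)
      case (step c x y)
      then obtain i where x: "x = m1 i" by blast
      have "g (a1 D x) = a2 D (g x)"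
        unfolding x V.act_expansion[of D] W.act_expansion[of D] g.sum g.scale g
        by (intro sum.cong refl arg_cong2[of _ _ _ _ s2] e) simp
      then show ?case using step by (simp add: g.add g.scale)
    qed simp
  qed
  let ?K = "{v. g v = 0}"
  have "V.subspace ?K \<and> (\<forall>D. \<forall>u\<in>?K. a1 D u \<in> ?K)"
    by (auto simp: V.subspace_def g.add g.scale hom)
  then have "?K = {0} \<or> ?K = UNIV" using irr unfolding witt_irreducible_def by blast
  moreover have "?K \<noteq> UNIV" using g[of 0] nz(2) by (metis UNIV_I mem_Collect_eq)
  ultimately have "inj g" unfolding g.inj_iff_eq_0 by blast
  moreover have "surj g"
  proof -
    have "range g = W.span (g ` range m1)" using g.span_image[of "range m1"] V.span_m by simp
    also have "g ` range m1 = range m2" by (auto simp: g image_def)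
    finally show ?thesis by (simp add: W.span_m)
  qed
  ultimately show thesis by (intro that[of g] g) (simp add: witt_module_iso_def lin hom bij_def)
qed


context density_module begin

text \<open>
  If \<open>m j\<close> were nonzero, the span of the vectors indexed by \<open>I\<close> would be a proper submodule, because the
  coordinate of \<open>m j\<close> vanishes on it. This excludes parameters \<open>b\<close> for which the action preserves such a span.
\<close>

lemma no_invariant_set_of_basis_vectors:
  assumes irr: "witt_irreducible scale act"
    and inv: "\<And>k i. -1 \<le> k \<Longrightarrow> i \<in> I \<Longrightarrow> act (witt_e k) (m i) \<in> span (m ` I)"
    and i: "i \<in> I" "m i \<noteq> 0" and j: "j \<notin> I"
  shows "m j = 0"
proof (rule ccontr)
  assume mj: "m j \<noteq> 0"
  have "vector_space ((*) :: 'a \<Rightarrow> 'a \<Rightarrow> 'a)"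
    by standard (simp_all add: algebra_simps)
  from linear_extension[OF this, of "\<lambda>i. if i = j then 1 else 0"]
  obtain g where "Vector_Spaces.linear scale (*) g \<and>
    (\<forall>i. m i \<noteq> 0 \<longrightarrow> g (m i) = (if i = j then 1 else 0))" ..
  then have g: "Vector_Spaces.linear scale (*) g"
    "\<And>i. m i \<noteq> 0 \<Longrightarrow> g (m i) = (if i = j then 1 else 0)" by simp_all
  have g_add: "g (x + y) = g x + g y" and g_scale: "g (scale c x) = c * g x" for x y c
    using g(1) by (simp_all add: Vector_Spaces.linear_iff)
  have g_zero: "g 0 = 0" using g_scale[of 0 0] by simp
  have "act D u \<in> span (m ` I)" if "u \<in> span (m ` I)" for D u
    by (rule span_invariantI[OF _ that]) (use inv in auto)
  then have "span (m ` I) = {0} \<or> span (m ` I) = UNIV"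
    using irr unfolding witt_irreducible_def by (simp add: subspace_span)
  moreover have "m i \<in> span (m ` I)" using i by (simp add: span_base)
  ultimately have "m j \<in> span (m ` I)" using i by auto
  then have "g (m j) = 0"
  proof (induction rule: span_induct_alt)
    case (step c x y)
    then obtain i where "x = m i" "i \<in> I" by blast
    with j g(2)[of i] have "g x = 0" by (cases "m i = 0") (auto simp: g_zero)
    then show ?case using step by (simp add: g_add g_scale)
  qed (simp add: g_zero)
  with g(2)[OF mj] show False by simp
qed

lemma one_dimensional_trivial:
  assumes p: "CHAR('a) \<ge> 5" and b: "b = 1"
    and only: "\<And>i. i \<noteq> CHAR('a) - 1 \<Longrightarrow> m i = 0" and top: "m (CHAR('a) - 1) \<noteq> 0"
  shows "witt_trivial scale act"
proof -
  let ?q = "CHAR('a) - 1"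
  have "vector_space ((*) :: 'a \<Rightarrow> 'a \<Rightarrow> 'a)"
    by standard (simp_all add: algebra_simps)
  from linear_extension[OF this, of "\<lambda>i. 1"]
  obtain g where "Vector_Spaces.linear scale (*) g \<and> (\<forall>i. m i \<noteq> 0 \<longrightarrow> g (m i) = 1)" ..
  then have lin: "Vector_Spaces.linear scale (*) g" and g: "g (m ?q) = (1 :: 'a)"
    using top by simp_all
  have g_add: "g (x + y) = g x + g y" and g_scale: "g (scale c x) = c * g x" for x y c
    using lin by (simp_all add: Vector_Spaces.linear_iff)
  have g_zero: "g 0 = 0" using g_scale[of 0 0] by simp
  have line: "\<exists>c. v = scale c (m ?q)" for v
  proof -
    obtain c where "v = (\<Sum>i<CHAR('a). scale (c i) (m i))" using sum_range[of v] p by auto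
    also have "\<dots> = (\<Sum>i\<in>{?q}. scale (c i) (m i))"
      using p only by (intro sum.mono_neutral_right) auto
    finally show ?thesis by auto
  qed
  have "act (witt_e k) (m ?q) = 0" if "-1 \<le> k" for k
  proof (cases "k = -1")
    case True
    then show ?thesis using lower[of ?q] only[of "?q - 1"] p by simp
  next
    case False
    then have k: "k = int (nat k)" using that by simp
    have "(of_nat ?q + 1 :: 'a) = of_nat (?q + 1)" by simp
    also have "?q + 1 = CHAR('a)" using p by simp
    finally have "(of_nat ?q + 1 :: 'a) = of_nat CHAR('a)" .
    then show ?thesis
      using raise[of "nat k" ?q] only[of "?q + nat k"] k b by (cases "nat k = 0") auto
  qed
  then have zero: "act D v = 0" for D v
    using line[of v] by (auto simp: act_expansion[of D] intro!: sum.neutral)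
  have "g (scale c (m ?q)) = c" for c using g by (simp only: g_scale mult_1_right)
  then have "bij g"
    by (intro bijI injI surjI[of _ "\<lambda>c. scale c (m ?q)"]) (metis line)+
  then show ?thesis
    unfolding witt_trivial_def witt_module_iso_def using lin zero by (intro exI[of _ g]) (simp add: g_zero)
qed

text \<open>
  If \<open>m 0 \<noteq> 0\<close>, then \<open>b = 0\<close> is impossible because \<open>m 0\<close> spans a submodule, and
  \<open>b = 1\<close> because the exact forms \<open>m 0, \<dots>, m (p - 2)\<close> do. Otherwise let \<open>r\<close> be the lowest index
  with \<open>m r \<noteq> 0\<close>. The operators \<open>e\<^sub>1\<close> and \<open>e\<^sub>2\<close> annihilate \<open>m (r - 1) = 0\<close>, so their coefficients
  \<open>r - 1 + 2 b\<close> and, if \<open>r < p - 1\<close>, \<open>r - 1 + 3 b\<close> vanish, which gives \<open>b = 0\<close> and \<open>r = 1\<close>. For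
  \<open>r = p - 1\<close> the module is trivial.
\<close>

lemma lowest_index:
  assumes p: "CHAR('a) \<ge> 5" and irr: "witt_irreducible scale act"
    and nt: "\<not> witt_trivial scale act" and top: "m (CHAR('a) - 1) \<noteq> 0"
  shows "m 0 \<noteq> 0 \<and> b \<noteq> 0 \<and> b \<noteq> 1 \<or> m 0 = 0 \<and> m 1 \<noteq> 0 \<and> b = 0"
proof -
  let ?p = "CHAR('a)"
  have small: "(of_nat i :: 'a) \<noteq> 0" if "0 < i" "i < ?p" for i
    using that by (auto simp: of_nat_eq_0_iff_char_dvd dest: dvd_imp_le)
  show ?thesis
  proof (cases "m 0 = 0")
    case False
    have "b \<noteq> 0"
    proof
      assume b: "b = 0"
      have "act (witt_e k) (m i) \<in> span (m ` {0})" if "-1 \<le> k" "i \<in> {0}" for k i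
      proof (cases "k = -1")
        case True
        then show ?thesis using that lower[of 0] by (simp add: span_zero)
      next
        case False
        then show ?thesis using that raise[of "nat k" 0] b by (simp add: span_zero)
      qed
      then have "m (?p - 1) = 0"
        using False p by (intro no_invariant_set_of_basis_vectors[OF irr, of "{0}" 0]) auto
      with top show False ..
    qed
    moreover have "b \<noteq> 1"
    proof
      assume b: "b = 1"
      have "act (witt_e k) (m i) \<in> span (m ` {..<?p - 1})" if "-1 \<le> k" "i \<in> {..<?p - 1}" for k i
      proof (cases "k = -1")
        case True
        have "m (i - 1) \<in> span (m ` {..<?p - 1})" using that by (intro span_base) auto
        then show ?thesis using True lower[of i] by (simp add: span_scale)
      next
        case False
        then have k: "k = int (nat k)" using that by simp
        consider "i + nat k < ?p - 1" | "i + nat k + 1 = ?p" | "?p \<le> i + nat k" by linarith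
        then show ?thesis
        proof cases
          case 1
          then show ?thesis using raise[of "nat k" i] k by (auto intro: span_scale span_base)
        next
          \<comment> \<open>The only coefficient that could lead to \<open>m (p - 1)\<close> is \<open>i + k + 1 = p\<close>.\<close>
          case 2
          then have "of_nat i + b * (of_nat (nat k) + 1) = (of_nat ?p :: 'a)"
            unfolding 2[symmetric] by (simp add: b algebra_simps)
          then have "of_nat i + b * (of_nat (nat k) + 1) = 0" by simp
          then show ?thesis using raise[of "nat k" i] k by (simp add: span_zero)
        next
          case 3
          then show ?thesis using raise[of "nat k" i] k m_beyond by (simp add: span_zero)
        qed
      qed
      then have "m (?p - 1) = 0"
        using False p by (intro no_invariant_set_of_basis_vectors[OF irr, of "{..<?p - 1}" 0]) auto
      with top show False ..
    qed
    ultimately show ?thesis using False by simp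
  next
    case True
    define r where "r = (LEAST r. m r \<noteq> 0)"
    have mr: "m r \<noteq> 0" unfolding r_def using top by (rule LeastI)
    have below: "m i = 0" if "i < r" for i using not_less_Least[of i "\<lambda>r. m r \<noteq> 0"] that unfolding r_def by blast
    obtain q where r: "r = Suc q" using mr True by (cases r) auto
    have rp: "r < ?p" using mr m_beyond[of r] by linarith
    have e1: "of_nat q + b * 2 = 0"
      using raise[of 1 q] below[of q] mr by (simp add: r)
    show ?thesis
    proof (cases "Suc r < ?p")
      case True
      have "m (Suc r) \<noteq> 0" using m_nonzero_upwards[OF mr, of "Suc r"] True by simp
      then have e2: "of_nat q + b * 3 = 0"
        using raise[of 2 q] below[of q] by (simp add: r)
      have "b = (of_nat q + b * 3) - (of_nat q + b * 2)" by (simp add: algebra_simps)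
      then have b: "b = 0" unfolding e1 e2 by simp
      then have "q = 0" using e1 small[of q] rp r by (cases "q = 0") auto
      then show ?thesis using b mr \<open>m 0 = 0\<close> r by simp
    next
      case False
      then have pr: "?p = Suc (Suc q)" using rp r by simp
      have "(of_nat q :: 'a) = - 2"
        using of_nat_CHAR[where ?'a = 'a] unfolding pr by (simp add: eq_neg_iff_add_eq_0 add.commute)
      then have "2 * (b - 1) = 0" using e1 by (simp add: algebra_simps)
      then have "b = 1" using small[of 2] p by simp
      have only: "m i = 0" if "i \<noteq> ?p - 1" for i
      proof (cases "i < r")
        case True
        then show ?thesis by (rule below)
      next
        case False
        then have "?p \<le> i" using that r pr by linarith
        then show ?thesis by (rule m_beyond)
      qed
      show ?thesis using nt one_dimensional_trivial[OF p \<open>b = 1\<close> only top] by simp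
    qed
  qed
qed

end


section \<open>The bilinear form of an invariant product\<close>

context density_module begin

definition is_coordinate :: "nat \<Rightarrow> ('v \<Rightarrow> 'a) \<Rightarrow> bool" where
  "is_coordinate r \<kappa> \<longleftrightarrow> Vector_Spaces.linear scale (*) \<kappa> \<and> (\<forall>i. \<kappa> (m i) = (if i = r then 1 else 0))"

lemma exists_coordinate:
  assumes "m r \<noteq> 0"
  obtains \<kappa> where "is_coordinate r \<kappa>"
proof -
  have "vector_space ((*) :: 'a \<Rightarrow> 'a \<Rightarrow> 'a)"
    by standard (simp_all add: algebra_simps)
  from linear_extension[OF this, of "\<lambda>i. if i = r then 1 else 0"]
  obtain g where "Vector_Spaces.linear scale (*) g \<and>
    (\<forall>i. m i \<noteq> 0 \<longrightarrow> g (m i) = (if i = r then 1 else 0))" ..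
  then have g: "Vector_Spaces.linear scale (*) g"
    "\<And>i. m i \<noteq> 0 \<Longrightarrow> g (m i) = (if i = r then 1 else 0)" by simp_all
  have g_add: "g (x + y) = g x + g y" and g_scale: "g (scale c x) = c * g x" for x y c
    using g(1) by (simp_all add: Vector_Spaces.linear_iff)
  have g_zero: "g 0 = 0" using g_scale[of 0 0] by simp
  have "g (m i) = (if i = r then 1 else 0)" for i
    using g(2)[of i] assms by (cases "m i = 0") (auto simp: g_zero)
  with g(1) show thesis using that unfolding is_coordinate_def by blast
qed

text \<open>
  The nonnegative part of \<open>W\<close> does not lower degrees, so it acts on the lowest coordinate through the
  weight of \<open>m r\<close>.
\<close>

lemma coordinate_e:
  assumes \<kappa>: "is_coordinate r \<kappa>" and below: "\<And>i. i < r \<Longrightarrow> m i = 0"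
  shows "\<kappa> (act (witt_e (int k)) v) = (if k = 0 then (of_nat r + b) * \<kappa> v else 0)"
proof -
  have g_add: "\<kappa> (x + y) = \<kappa> x + \<kappa> y" and g_scale: "\<kappa> (scale c x) = c * \<kappa> x" for x y c
    using \<kappa> by (simp_all add: Vector_Spaces.linear_iff is_coordinate_def)
  have g_zero: "\<kappa> 0 = 0" using g_scale[of 0 0] by simp
  have \<kappa>m: "\<kappa> (m i) = (if i = r then 1 else 0)" for i using \<kappa> by (simp add: is_coordinate_def)
  have "v \<in> span (range m)" using span_m by simp
  then show ?thesis
  proof (induction rule: span_induct_alt)
    case (step c x y)
    then obtain i where x: "x = m i" by blast
    have "\<kappa> (act (witt_e (int k)) x) = (if k = 0 then (of_nat r + b) * \<kappa> x else 0)"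
    proof (cases "k = 0")
      case True
      have "act (witt_e 0) x = scale (of_nat i + b) x" using raise[of 0 i] by (simp add: x)
      then show ?thesis using True by (simp add: x g_scale \<kappa>m)
    next
      case False
      show ?thesis
      proof (cases "i < r")
        case True
        then show ?thesis using \<open>k \<noteq> 0\<close> below[of i] by (simp add: x g_zero)
      next
        case False
        then have "i + k \<noteq> r" using \<open>k \<noteq> 0\<close> by linarith
        then show ?thesis using \<open>k \<noteq> 0\<close> raise[of k i] by (simp only: x g_scale \<kappa>m) simp
      qed
    qed
    then show ?case using step by (cases "k = 0") (simp_all add: g_add g_scale distrib_left mult.left_commute)
  qed (simp add: g_zero)
qed

end

lemma invariant_productD:
  assumes "witt_invariant_product s a prd"
  shows "prd (u + u') v = prd u v + prd u' v" "prd u (v + v') = prd u v + prd u v'"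
    "prd (s c u) v = s c (prd u v)" "prd u (s c v) = s c (prd u v)"
    "a D (prd u v) = prd (a D u) v + prd u (a D v)"
  using assms by (simp_all add: witt_invariant_product_def Vector_Spaces.linear_iff)

context density_module begin

text \<open>
  The span of all products is a submodule. If it lies in the kernel of \<open>\<kappa>\<close>, it is proper and
  therefore zero.
\<close>

lemma invariant_product_eq_0:
  assumes irr: "witt_irreducible scale act" and inv: "witt_invariant_product scale act prd"
    and \<kappa>: "is_coordinate r \<kappa>" and zero: "\<And>i j. \<kappa> (prd (m i) (m j)) = 0"
  shows "prd u v = 0"
proof -
  note prd = invariant_productD[OF inv]
  have g_add: "\<kappa> (x + y) = \<kappa> x + \<kappa> y" and g_scale: "\<kappa> (scale c x) = c * \<kappa> x" for x y c
    using \<kappa> by (simp_all add: Vector_Spaces.linear_iff is_coordinate_def)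
  have g_zero: "\<kappa> 0 = 0" using g_scale[of 0 0] by simp
  have prd0: "prd 0 v = 0" "prd u 0 = 0" for u v
    using prd(3)[of 0 0 v] prd(4)[of u 0 0] by simp_all
  have ker: "\<kappa> (prd u v) = 0" for u v
  proof -
    have "v \<in> span (range m)" "u \<in> span (range m)" using span_m by simp_all
    from this(1) have left: "\<kappa> (prd (m i) v) = 0" for i
      by (induction rule: span_induct_alt) (auto simp: prd prd0 g_add g_scale g_zero zero)
    show ?thesis using \<open>u \<in> span (range m)\<close>
      by (induction rule: span_induct_alt) (auto simp: prd prd0 g_add g_scale g_zero left)
  qed
  define S where "S = {x. \<exists>u v. x = prd u v}"
  have S: "prd u v \<in> span S" for u v
    by (rule span_base) (auto simp: S_def)
  have "\<kappa> x = 0" if "x \<in> span S" for x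
    using that by (induction rule: span_induct_alt) (auto simp: S_def g_add g_scale g_zero ker)
  moreover have "\<kappa> (m r) = 1" using \<kappa> by (simp add: is_coordinate_def)
  ultimately have "m r \<notin> span S" by fastforce
  then have "span S \<noteq> UNIV" by blast
  moreover have "act D x \<in> span S" if "x \<in> span S" for D x
  proof (rule span_invariantI[OF _ that])
    show "act (witt_e k) x \<in> span S" if "x \<in> S" for k x
    proof -
      from that obtain u v where x: "x = prd u v" unfolding S_def by blast
      show ?thesis unfolding x prd(5) by (rule span_add[OF S S])
    qed
  qed
  ultimately have "span S = {0}"
    using irr subspace_span[of S] unfolding witt_irreducible_def by blast
  with S show ?thesis by simp
qed

context
  fixes prd r \<kappa> \<phi>
  assumes inv: "witt_invariant_product scale act prd"
    and \<kappa>: "is_coordinate r \<kappa>" and below: "\<And>i. i < r \<Longrightarrow> m i = 0"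
  defines "\<phi> \<equiv> \<lambda>i j. \<kappa> (prd (m i) (m j))"
begin

lemma form_e:
  "(if k = 0 then (of_nat r + b) * \<phi> i j else 0) =
     (of_nat i + b * (of_nat k + 1)) * \<phi> (i + k) j + (of_nat j + b * (of_nat k + 1)) * \<phi> i (j + k)"
proof -
  note prd = invariant_productD[OF inv]
  have g_add: "\<kappa> (x + y) = \<kappa> x + \<kappa> y" and g_scale: "\<kappa> (scale c x) = c * \<kappa> x" for x y c
    using \<kappa> by (simp_all add: Vector_Spaces.linear_iff is_coordinate_def)
  have "(if k = 0 then (of_nat r + b) * \<phi> i j else 0) = \<kappa> (act (witt_e (int k)) (prd (m i) (m j)))"
    unfolding \<phi>_def by (rule coordinate_e[OF \<kappa> below, symmetric])
  also have "\<dots> = (of_nat i + b * (of_nat k + 1)) * \<phi> (i + k) j +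
      (of_nat j + b * (of_nat k + 1)) * \<phi> i (j + k)"
    by (simp only: prd raise g_add g_scale \<phi>_def)
  finally show ?thesis .
qed

lemma form_zero: "m i = 0 \<or> m j = 0 \<Longrightarrow> \<phi> i j = 0"
proof -
  note prd = invariant_productD[OF inv]
  have "prd 0 v = 0" "prd u 0 = 0" for u v
    using prd(3)[of 0 0 v] prd(4)[of u 0 0] by simp_all
  moreover have "\<kappa> (scale c x) = c * \<kappa> x" for x c
    using \<kappa> by (simp_all add: Vector_Spaces.linear_iff is_coordinate_def)
  from this[of 0 0] have "\<kappa> 0 = 0" by simp
  ultimately show "m i = 0 \<or> m j = 0 \<Longrightarrow> \<phi> i j = 0" by (auto simp: \<phi>_def)
qed

lemma form_weight: "\<phi> i j \<noteq> 0 \<Longrightarrow> of_nat (i + j) + b = of_nat r"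
proof -
  assume nz: "\<phi> i j \<noteq> 0"
  have "(of_nat (i + j) + b - of_nat r) * \<phi> i j = 0"
    using form_e[of 0 i j] by (simp add: algebra_simps)
  with nz show ?thesis by simp
qed

lemma form_zero_generic:
  assumes p: "CHAR('a) \<ge> 5" and b: "b = - of_nat s" "2 \<le> s" "s + 2 \<le> CHAR('a)" and r: "r = 0"
    and exceptional: "s = 3 \<Longrightarrow> CHAR('a) = 7 \<Longrightarrow> \<phi> 0 3 = 0"
  shows "\<phi> i j = 0"
proof (rule form_invariant_under_positive_part_vanishes[OF refl p b(2,3)])
  show "\<phi> i j = 0" if "CHAR('a) \<le> i \<or> CHAR('a) \<le> j" for i j
    using that m_beyond form_zero by blast
  show "of_nat (i + j) = (of_nat s :: 'a)" if "\<phi> i j \<noteq> 0" for i j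
    using form_weight[OF that] by (simp add: b r)
  show "(of_nat i - of_nat s * (of_nat k + 1)) * \<phi> (i + k) j +
        (of_nat j - of_nat s * (of_nat k + 1)) * \<phi> i (j + k) = 0" if "1 \<le> k" for k i j
    using form_e[of k i j] that by (simp add: b)
qed (use exceptional in auto)

text \<open>
  For the quotient of the truncated polynomials by the constants, the recursion for \<open>e\<^sub>1\<close> says that the
  form is constant along the only possible antidiagonal \<open>i + j = p + 1\<close>, and it is zero at the end
  \<open>i = 1\<close> because \<open>m p = 0\<close>.
\<close>

lemma form_zero_quotient:
  assumes p: "CHAR('a) \<ge> 5" and b: "b = 0" "r = 1"
  shows "\<phi> i j = 0"
proof (rule ccontr)
  let ?p = "CHAR('a)"
  assume nz: "\<phi> i j \<noteq> 0"
  then have "m i \<noteq> 0" "m j \<noteq> 0" using form_zero by blast+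
  then have i: "0 < i" "i < ?p" and j: "0 < j" "j < ?p"
    using below m_beyond b by (metis gr0I less_one not_le)+
  have "(of_nat 1 :: 'a) = of_nat (i + j)" using form_weight[OF nz] b by simp
  then have "?p dvd i + j - 1"
    using of_nat_eq_iff_char_dvd[where ?'a = 'a, of 1 "i + j"] i j by simp
  then obtain q where q: "i + j - 1 = ?p * q" by (auto simp: dvd_def)
  moreover have "0 < i + j - 1" "i + j - 1 < ?p * 2" using i j by auto
  ultimately have "q = 1" by (cases q) auto
  then have j': "j = ?p + 1 - i" using q i by simp
  have "\<phi> i (?p + 1 - i) = 0" if "1 \<le> i" "i \<le> ?p" for i
    using that
  proof (induction rule: dec_induct)
    case base
    show ?case using m_beyond by (intro form_zero) simp
  next
    case (step i)
    have "(of_nat i :: 'a) \<noteq> 0" using step by (auto simp: of_nat_eq_0_iff_char_dvd dest: dvd_imp_le)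
    moreover have "?p - i + 1 = ?p + 1 - i" "?p + 1 - Suc i = ?p - i" using step by auto
    ultimately show ?case using form_e[of 1 i "?p - i"] step by (simp add: b)
  qed
  from this[of i] i j' nz show False by simp
qed

end

end

context witt_module begin

text \<open>
  Write \<open>b = -s\<close> with \<open>0 \<le> s < p\<close>. Irreducibility excludes \<open>s = p - 1\<close> and leaves for \<open>s = 0\<close> only
  the quotient by the constants, where the form of the product is zero. The case \<open>s = 1\<close> is that of the adjoint
  module, and for the other \<open>s\<close> the form is zero unless \<open>s = 3\<close> and \<open>p = 7\<close>.
\<close>

lemma invariant_product_classification:
  assumes res: "witt_restricted act" and irr: "witt_irreducible scale act" and p: "CHAR('a) \<ge> 5"
    and nt: "\<not> witt_trivial scale act"
    and inv: "witt_invariant_product scale act prd" and nz: "prd u v \<noteq> 0"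
  obtains b m where "density_module scale act b m" "m 0 \<noteq> 0" "b = -1 \<or> CHAR('a) = 7 \<and> b = 4"
proof -
  let ?p = "CHAR('a)"
  obtain n m where "density_module scale act (of_nat n) m" and top: "m (?p - 1) \<noteq> 0"
    using restricted_irreducible_is_density_module[OF res irr p] by blast
  then interpret density_module scale act "of_nat n" m by simp
  \<comment> \<open>The representative of \<open>-n\<close> modulo \<open>p\<close> in the range from \<open>0\<close> to \<open>p - 1\<close>.\<close>
  define s where "s = (if n mod ?p = 0 then 0 else ?p - n mod ?p)"
  have mod: "n mod ?p < ?p" using p by (intro mod_less_divisor) simp
  then have s: "s < ?p" using p by (auto simp: s_def)
  have "(of_nat n :: 'a) = of_nat (?p * (n div ?p) + n mod ?p)" by simp
  also have "\<dots> = of_nat (n mod ?p)" by (simp only: of_nat_add of_nat_mult of_nat_CHAR) simp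
  also have "\<dots> = - of_nat s" using mod by (simp add: s_def of_nat_diff)
  finally have b: "of_nat n = (- of_nat s :: 'a)" .
  from lowest_index[OF p irr nt top]
  show thesis
  proof (elim disjE conjE)
    assume 0: "m 0 \<noteq> 0" and b0: "of_nat n \<noteq> (0 :: 'a)" and b1: "of_nat n \<noteq> (1 :: 'a)"
    obtain \<kappa> where \<kappa>: "is_coordinate 0 \<kappa>" using exists_coordinate[OF 0] .
    show thesis
    proof (cases "s = 1 \<or> s = 3 \<and> ?p = 7")
      case True
      have "(of_nat 7 :: 'a) = 0" if "?p = 7" using of_nat_CHAR[where ?'a = 'a] that by simp
      then have "(- 3 :: 'a) = 4" if "?p = 7" using that by (simp add: eq_neg_iff_add_eq_0 neg_eq_iff_add_eq_0)
      with True have "of_nat n = (-1 :: 'a) \<or> ?p = 7 \<and> of_nat n = (4 :: 'a)"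
        unfolding b by auto
      then show thesis using that[OF density_module_axioms 0] by blast
    next
      case False
      have "s \<noteq> 0" using b b0 by (cases s) auto
      moreover have "s \<noteq> ?p - 1"
      proof
        assume "s = ?p - 1"
        then have "of_nat (s + 1) = (0 :: 'a)" using p by simp
        then have "of_nat s = (- 1 :: 'a)" by (simp add: eq_neg_iff_add_eq_0 add.commute)
        then show False using b b1 by simp
      qed
      ultimately have s2: "2 \<le> s" "s + 2 \<le> ?p" using False s by auto
      have "\<kappa> (prd (m i) (m j)) = 0" for i j
        by (rule form_zero_generic[OF inv \<kappa> _ p b s2]) (use False in auto)
      then have "prd u v = 0" by (rule invariant_product_eq_0[OF irr inv \<kappa>])
      with nz show thesis by simp
    qed
  next
    assume 0: "m 0 = 0" and 1: "m 1 \<noteq> 0" and b0: "of_nat n = (0 :: 'a)"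
    obtain \<kappa> where \<kappa>: "is_coordinate 1 \<kappa>" using exists_coordinate[OF 1] .
    have "\<kappa> (prd (m i) (m j)) = 0" for i j
      by (rule form_zero_quotient[OF inv \<kappa> _ p b0]) (use 0 in auto)
    then have "prd u v = 0" by (rule invariant_product_eq_0[OF irr inv \<kappa>])
    with nz show thesis by simp
  qed
qed

end


section \<open>Tensor densities and the adjoint module\<close>

text \<open>
  Leibniz rule for a pairing \<open>\<mu>\<close> between two further spaces. It is used both for the product of tensor
  densities and for the evaluation of a derivation at an element.
\<close>

lemma (in vector_space) leibniz_funpow:
  assumes add: "\<And>x y. A (x + y) = A x + A y" and smult: "\<And>c x. A (scale c x) = scale c (A x)"
    and leib: "\<And>x y. A (\<mu> x y) = \<mu> (B x) y + \<mu> x (C y)"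
  shows "(A ^^ n) (\<mu> x y) = (\<Sum>k\<le>n. scale (of_nat (n choose k)) (\<mu> ((B ^^ k) x) ((C ^^ (n - k)) y)))"
proof (induction n)
  case (Suc n)
  let ?a = "\<lambda>k l. \<mu> ((B ^^ k) x) ((C ^^ l) y)"
  let ?t = "\<lambda>k. scale (of_nat (n choose k)) (?a k (Suc n - k))"
  have A0: "A 0 = 0" using add[of 0 0] by simp
  have sum: "A (\<Sum>k\<in>S. h k) = (\<Sum>k\<in>S. A (h k))" if "finite S" for S and h :: "nat \<Rightarrow> 'b"
    using that by (induction S rule: finite_induct) (auto simp: add A0)
  have "(A ^^ Suc n) (\<mu> x y) = (\<Sum>k\<le>n. scale (of_nat (n choose k)) (?a (Suc k) (n - k) + ?a k (Suc n - k)))"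
    by (simp add: Suc.IH sum smult leib Suc_diff_le)
  also have "\<dots> = (\<Sum>k\<le>n. scale (of_nat (n choose k)) (?a (Suc k) (n - k))) + (\<Sum>k\<le>n. ?t k)"
    by (simp only: scale_right_distrib sum.distrib)
  also have "(\<Sum>k\<le>n. ?t k) = (\<Sum>k\<le>Suc n. ?t k)"
    by (simp add: binomial_eq_0)
  also have "\<dots> = ?t 0 + (\<Sum>k\<le>n. scale (of_nat (n choose Suc k)) (?a (Suc k) (n - k)))"
    by (subst sum.atMost_Suc_shift) simp
  also have "(\<Sum>k\<le>n. scale (of_nat (n choose k)) (?a (Suc k) (n - k))) + \<dots> =
      ?t 0 + (\<Sum>k\<le>n. scale (of_nat (Suc n choose Suc k)) (?a (Suc k) (n - k)))"
    by (simp add: sum.distrib scale_left_distrib algebra_simps)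
  also have "\<dots> = (\<Sum>k\<le>Suc n. scale (of_nat (Suc n choose k)) (?a k (Suc n - k)))"
    by (subst sum.atMost_Suc_shift) simp
  finally show ?case .
qed simp

lemma (in vector_space) leibniz_power_CHAR:
  assumes "\<And>x y. A (x + y) = A x + A y" "\<And>c x. A (scale c x) = scale c (A x)"
    and "\<And>x y. A (\<mu> x y) = \<mu> (B x) y + \<mu> x (C y)"
    and p: "CHAR('a) = p" "p > 0"
  shows "(A ^^ p) (\<mu> x y) = \<mu> ((B ^^ p) x) y + \<mu> x ((C ^^ p) y)"
proof -
  have prime: "prime p" using prime_CHAR_semidom[where ?'a = 'a] p by auto
  let ?t = "\<lambda>k. scale (of_nat (p choose k)) (\<mu> ((B ^^ k) x) ((C ^^ (p - k)) y))"
  have "?t k = 0" if "k \<in> {..p} - {0, p}" for k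
  proof -
    have "p dvd (p choose k)" using that prime p by (intro dvd_choose_prime) auto
    then have "(of_nat (p choose k) :: 'a) = 0" using p by (simp add: of_nat_eq_0_iff_char_dvd)
    then show ?thesis by simp
  qed
  then have "sum ?t {..p} = sum ?t {0, p}" by (intro sum.mono_neutral_right) auto
  with p show ?thesis unfolding leibniz_funpow[where \<mu> = \<mu> and B = B and C = C, OF assms(1-3)] by (simp add: add.commute)
qed

lemma witt_derivation: "is_derivation (witt_apply D)"
  using witt_apply by blast

lemma witt_apply_add: "witt_apply D (f + g) = witt_apply D f + witt_apply D g"
  and witt_apply_smult: "witt_apply D (trunc_smult c f) = trunc_smult c (witt_apply D f)"
  and witt_apply_mult: "witt_apply D (f * g) = witt_apply D f * g + f * witt_apply D g"
  using witt_derivation[of D] by (simp_all add: is_derivation_altdef)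

lemma witt_apply_diff: "witt_apply D (f - g) = witt_apply D f - witt_apply D g"
  using witt_apply_add[of D "f - g" g] by simp

lemma witt_apply_eq: "witt_apply D f = witt_apply D trunc_x * trunc_pderiv f"
  by (rule is_derivation_eq[OF witt_derivation])

lemma trunc_pderiv_add: "trunc_pderiv (f + g) = trunc_pderiv f + trunc_pderiv g"
  by transfer (simp add: trunc_rel_def pderiv_add)

lemma trunc_pderiv_diff: "trunc_pderiv (f - g) = trunc_pderiv f - trunc_pderiv g"
  by transfer (simp add: trunc_rel_def pderiv_diff)

lemma trunc_pderiv_smult: "trunc_pderiv (trunc_smult c f) = trunc_smult c (trunc_pderiv f)"
  by transfer (simp add: trunc_rel_def pderiv_smult)

lemma trunc_pderiv_mult: "trunc_pderiv (f * g) = trunc_pderiv f * g + f * trunc_pderiv g"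
  by transfer (simp add: trunc_rel_def pderiv_mult algebra_simps)

lemma obtain_witt_with_value:
  obtains E where "witt_apply E trunc_x = g"
proof (rule that)
  show "witt_apply (Witt (\<lambda>f. g * trunc_pderiv f)) trunc_x = g"
    by (simp add: Witt_inverse is_derivation_times_pderiv trunc_pderiv_x trunc_one)
qed

lemma witt_module_adjoint: "witt_module witt_scale (witt_bracket :: 'a::field witt \<Rightarrow> _)"
proof (intro witt_module.intro witt_module_axioms.intro witt.vector_space_axioms)
  have witt_add: "witt_bracket D (E + E') = witt_bracket D E + witt_bracket D E'" for D E E' :: "'a witt"
    by transfer (auto simp: is_derivation_altdef)
  have add_witt: "witt_bracket (D + D') E = witt_bracket D E + witt_bracket D' E" for D D' E :: "'a witt"
    by transfer (auto simp: is_derivation_altdef)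
  have witt_smult: "witt_bracket D (witt_scale c E) = witt_scale c (witt_bracket D E)" for c and D E :: "'a witt"
    by transfer (auto simp: is_derivation_altdef trunc_poly.scale_right_diff_distrib)
  have smult_witt: "witt_bracket (witt_scale c D) E = witt_scale c (witt_bracket D E)" for c and D E :: "'a witt"
    by transfer (auto simp: is_derivation_altdef trunc_poly.scale_right_diff_distrib)
  show "Vector_Spaces.linear witt_scale witt_scale (witt_bracket D)" for D :: "'a witt"
    by (auto simp: Vector_Spaces.linear_iff witt.vector_space_axioms witt_add witt_smult)
  show "Vector_Spaces.linear witt_scale witt_scale (\<lambda>D. witt_bracket D E)" for E :: "'a witt"
    by (auto simp: Vector_Spaces.linear_iff witt.vector_space_axioms add_witt smult_witt)
  show "witt_bracket (witt_bracket D E) F =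
      witt_bracket D (witt_bracket E F) - witt_bracket E (witt_bracket D F)" for D E F :: "'a witt"
    by (rule witt_eqI) (simp add: witt_bracket.rep_eq minus_witt.rep_eq witt_apply_diff)
qed

text \<open>
  Apply the Leibniz rule in characteristic \<open>p\<close> to the evaluation pairing \<open>(E, f) \<mapsto> E f\<close>, on which
  \<open>D\<close> acts by \<open>D (E f) = [D, E] f + E (D f)\<close>.
\<close>

lemma adjoint_restricted:
  assumes p: "CHAR('a::field) = p" "p > 0"
  shows "witt_bracket (witt_pmap D) E = (witt_bracket D ^^ p) (E :: 'a witt)"
proof (rule witt_eqI)
  have "(witt_apply D ^^ p) (witt_apply E trunc_x) =
      witt_apply ((witt_bracket D ^^ p) E) trunc_x + witt_apply E ((witt_apply D ^^ p) trunc_x)"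
    by (rule trunc_poly.leibniz_power_CHAR[where \<mu> = witt_apply, OF witt_apply_add witt_apply_smult _ p])
      (simp add: witt_bracket.rep_eq)
  then show "witt_apply (witt_bracket (witt_pmap D) E) trunc_x = witt_apply ((witt_bracket D ^^ p) E) trunc_x"
    using p by (simp add: witt_bracket.rep_eq witt_pmap.rep_eq)
qed

text \<open>
  The vector field \<open>x\<^sup>i \<partial>\<close> behaves like \<open>x\<^sup>i (dx)\<^sup>-\<^sup>1\<close>.
\<close>

lemma density_module_adjoint:
  assumes "CHAR('a::field) \<ge> 5"
  shows "density_module witt_scale witt_bracket (-1 :: 'a) (\<lambda>i. witt_e (int i - 1))"
proof -
  interpret witt_module witt_scale "witt_bracket :: 'a witt \<Rightarrow> _" by (rule witt_module_adjoint)
  show ?thesis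
  proof
    show "witt_bracket (witt_e (-1)) (witt_e (int i - 1)) = witt_scale (of_nat i) (witt_e (int (i - 1) - 1) :: 'a witt)" for i
      by (cases i) (simp_all add: witt_bracket_e algebra_simps)
    show "witt_bracket (witt_e (int k)) (witt_e (int i - 1)) =
      witt_scale (of_nat i + - 1 * (of_nat k + 1)) (witt_e (int (i + k) - 1) :: 'a witt)" for i k
      by (simp add: witt_bracket_e algebra_simps)
    show "witt_e (int i - 1) = (0 :: 'a witt)" if "CHAR('a) \<le> i" for i
      using that by (intro witt_e_eq_0) auto
    show "witt.span (range (\<lambda>i. witt_e (int i - 1))) = (UNIV :: 'a witt set)"
    proof -
      have "witt_e k \<in> range (\<lambda>i. witt_e (int i - 1) :: 'a witt)" if "-1 \<le> k" for k
        using that by (intro range_eqI[of _ _ "nat (k + 1)"]) simp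
      then have "D \<in> witt.span (range (\<lambda>i. witt_e (int i - 1)))" for D :: "'a witt"
        by (subst witt_expansion[of D]) (intro witt.span_sum witt.span_scale witt.span_base, simp)
      then show ?thesis by blast
    qed
  qed
qed

text \<open>
  The Lie derivative of \<open>g (dx)\<^sup>b\<close> along \<open>D\<close>, divided by \<open>(dx)\<^sup>b\<close>.
\<close>

definition tensor_density :: "'a::field \<Rightarrow> 'a witt \<Rightarrow> 'a trunc_poly \<Rightarrow> 'a trunc_poly" where
  "tensor_density b D g = witt_apply D g + trunc_smult b (trunc_pderiv (witt_apply D trunc_x) * g)"

lemma tensor_density_add: "tensor_density b D (f + g) = tensor_density b D f + tensor_density b D g"
  and tensor_density_smult: "tensor_density b D (trunc_smult c g) = trunc_smult c (tensor_density b D g)"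
  by (simp_all add: tensor_density_def witt_apply_add witt_apply_smult trunc_smult_mult
      trunc_poly.scale_right_distrib algebra_simps)

lemma tensor_density_mult:
  "tensor_density (b + c) D (f * g) = tensor_density b D f * g + f * tensor_density c D g"
  by (simp add: tensor_density_def witt_apply_mult trunc_smult_mult
      trunc_poly.scale_right_distrib trunc_poly.scale_left_distrib algebra_simps)

lemma tensor_density_bracket:
  "tensor_density b (witt_bracket D E) g =
     tensor_density b D (tensor_density b E g) - tensor_density b E (tensor_density b D g)"
proof -
  have "trunc_pderiv (witt_apply (witt_bracket D E) trunc_x) =
      witt_apply D (trunc_pderiv (witt_apply E trunc_x)) - witt_apply E (trunc_pderiv (witt_apply D trunc_x))"
    unfolding witt_bracket.rep_eq witt_apply_eq[of D "witt_apply E trunc_x"]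
      witt_apply_eq[of E "witt_apply D trunc_x"] witt_apply_eq[of D "trunc_pderiv _"]
      witt_apply_eq[of E "trunc_pderiv _"]
    by (simp add: trunc_pderiv_diff trunc_pderiv_mult algebra_simps)
  then show ?thesis
    unfolding tensor_density_def
    by (simp only:) (simp add: witt_bracket.rep_eq witt_apply_add witt_apply_smult witt_apply_mult
        trunc_smult_mult trunc_poly.scale_right_distrib trunc_poly.scale_right_diff_distrib algebra_simps)
qed

lemma tensor_density_restricted_adjoint:
  fixes D :: "'a::field witt"
  assumes p: "CHAR('a) = p" "p > 0"
  shows "tensor_density (-1) (witt_pmap D) g = (tensor_density (-1) D ^^ p) g"
proof -
  have bracket: "tensor_density (-1) D (witt_apply E trunc_x) = witt_apply (witt_bracket D E) trunc_x" for D E :: "'a witt"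
    by (simp add: tensor_density_def witt_bracket.rep_eq witt_apply_eq[of E "witt_apply D trunc_x"] algebra_simps
        trunc_poly.scale_minus_left)
  have pow: "(tensor_density (-1) D ^^ n) (witt_apply E trunc_x) = witt_apply ((witt_bracket D ^^ n) E) trunc_x" for n E
    by (induction n) (simp_all add: bracket)
  obtain E where "witt_apply E trunc_x = g" by (rule obtain_witt_with_value)
  then show ?thesis
    using bracket[of "witt_pmap D" E] pow[of p E] adjoint_restricted[OF p, of D E] by simp
qed

text \<open>
  Every density of weight \<open>b + c\<close> is a product \<open>g \<cdot> 1\<close> of densities of weights \<open>b\<close> and
  \<open>c\<close>, and both sides of the claim act on products by the Leibniz rule.
\<close>

lemma tensor_density_restricted_add:
  fixes D :: "'a::field witt"
  assumes p: "CHAR('a) = p" "p > 0"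
    and b: "\<And>g. tensor_density b (witt_pmap D) g = (tensor_density b D ^^ p) g"
    and c: "\<And>g. tensor_density c (witt_pmap D) g = (tensor_density c D ^^ p) g"
  shows "tensor_density (b + c) (witt_pmap D) g = (tensor_density (b + c) D ^^ p) g"
proof -
  have "(tensor_density (b + c) D ^^ p) (g * trunc_monom 0) =
      (tensor_density b D ^^ p) g * trunc_monom 0 + g * (tensor_density c D ^^ p) (trunc_monom 0)"
    by (rule trunc_poly.leibniz_power_CHAR[where \<mu> = "(*)",
          OF tensor_density_add tensor_density_smult tensor_density_mult p])
  also have "\<dots> = tensor_density (b + c) (witt_pmap D) (g * trunc_monom 0)"
    by (simp only: b[symmetric] c[symmetric] tensor_density_mult)
  finally show ?thesis by (simp add: trunc_one)
qed

lemma tensor_density_restricted: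
  fixes D :: "'a::field witt"
  assumes p: "CHAR('a) = p" "p > 0"
  shows "tensor_density (- of_nat (Suc n)) (witt_pmap D) g = (tensor_density (- of_nat (Suc n)) D ^^ p) g"
proof (induction n arbitrary: g)
  case 0
  show ?case using tensor_density_restricted_adjoint[OF p] by simp
next
  case (Suc n)
  have "tensor_density (- of_nat (Suc n) + - 1) (witt_pmap D) g = (tensor_density (- of_nat (Suc n) + - 1) D ^^ p) g"
    using Suc.IH tensor_density_restricted_adjoint[OF p] by (intro tensor_density_restricted_add[OF p])
  moreover have "- of_nat (Suc n) + - 1 = (- of_nat (Suc (Suc n)) :: 'a)" by simp
  ultimately show ?case by (simp only:)
qed

lemma tensor_density_e_monom:
  "tensor_density b (witt_e (int a - 1)) (trunc_monom n) =
     trunc_smult (of_nat n + b * of_nat a) (trunc_monom (a + n - 1) :: 'a::field trunc_poly)"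
proof -
  have "trunc_smult (of_nat n) (trunc_monom a * trunc_monom (n - Suc 0)) =
      (trunc_smult (of_nat n) (trunc_monom (a + n - Suc 0)) :: 'a trunc_poly)"
    by (cases n) (simp_all add: trunc_monom_mult)
  moreover have "trunc_smult (of_nat a) (trunc_monom (a - Suc 0) * trunc_monom n) =
      (trunc_smult (of_nat a) (trunc_monom (a + n - Suc 0)) :: 'a trunc_poly)"
    by (cases a) (simp_all add: trunc_monom_mult)
  ultimately show ?thesis
    by (simp add: tensor_density_def witt_e.rep_eq witt_e_x trunc_pderiv_monom trunc_smult_mult trunc_one
        trunc_poly.scale_left_distrib del: trunc_poly.scale_cancel_left flip: trunc_poly.scale_scale)
qed

lemma tensor_density_left_add: "tensor_density b (D + E) g = tensor_density b D g + tensor_density b E g"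
  and tensor_density_left_scale: "tensor_density b (witt_scale c D) g = trunc_smult c (tensor_density b D g)"
  by (simp_all add: tensor_density_def plus_witt.rep_eq witt_scale.rep_eq trunc_pderiv_add trunc_pderiv_smult
      trunc_smult_mult trunc_poly.scale_right_distrib mult.commute algebra_simps)

lemma linear_tensor_density:
  "Vector_Spaces.linear trunc_smult trunc_smult (tensor_density b D)"
  "Vector_Spaces.linear witt_scale trunc_smult (\<lambda>D. tensor_density b D g)"
  by (auto simp: Vector_Spaces.linear_iff trunc_poly.vector_space_axioms witt.vector_space_axioms
      tensor_density_add tensor_density_smult tensor_density_left_add tensor_density_left_scale)

interpretation tensor_density: witt_module trunc_smult "tensor_density b"
  by (intro witt_module.intro witt_module_axioms.intro trunc_poly.vector_space_axioms
      linear_tensor_density tensor_density_bracket)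


section \<open>The module \<open>V\<^sub>6\<close> and its product\<close>

lemma V6_expansion: "v = (\<Sum>i\<in>{0..6::int}. (v $ of_int i) *s V6_basis i)" for v :: "'a::field ^ 7"
  unfolding vec_eq_iff
proof
  fix j :: 7
  show "v $ j = (\<Sum>i\<in>{0..6::int}. (v $ of_int i) *s V6_basis i) $ j"
  proof (cases j)
    case (of_int z)
    then have z: "z \<in> {0..6}" by simp
    have "(\<Sum>i\<in>{0..6::int}. (v $ of_int i) *s V6_basis i) $ j =
        (\<Sum>i\<in>{0..6::int}. if i = z then v $ of_int i else 0)"
      unfolding of_int sum_component vector_smult_component
      by (intro sum.cong refl) (use z in \<open>simp add: V6_basis_nth\<close>)
    then show ?thesis using z by (simp add: of_int)
  qed
qed

text \<open>
  The identification of \<open>V\<^sub>6\<close> with the tensor densities \<open>g (dx)\<^sup>4\<close>.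
\<close>

definition poly_of_V6 :: "'a::field ^ 7 \<Rightarrow> 'a trunc_poly" where
  "poly_of_V6 v = (\<Sum>i\<in>{0..6::int}. trunc_smult (v $ of_int i) (trunc_monom (nat i)))"

lemma poly_of_V6_add: "poly_of_V6 (u + v) = poly_of_V6 u + poly_of_V6 v"
  by (simp add: poly_of_V6_def trunc_poly.scale_left_distrib sum.distrib)

lemma poly_of_V6_scale: "poly_of_V6 (c *s v) = trunc_smult c (poly_of_V6 v)"
  by (simp add: poly_of_V6_def trunc_poly.scale_sum_right)

lemma poly_of_V6_zero: "poly_of_V6 0 = 0"
  by (simp add: poly_of_V6_def)

lemma poly_of_V6_sum: "poly_of_V6 (sum h A) = (\<Sum>a\<in>A. poly_of_V6 (h a))"
  by (induction A rule: infinite_finite_induct) (simp_all add: poly_of_V6_add poly_of_V6_zero)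

lemma poly_of_V6_basis:
  assumes "i \<in> {0..6}"
  shows "poly_of_V6 (V6_basis i) = trunc_monom (nat i)"
proof -
  have "poly_of_V6 (V6_basis i) = (\<Sum>j\<in>{0..6}. if j = i then trunc_monom (nat j) else (0 :: 'a trunc_poly))"
    unfolding poly_of_V6_def by (intro sum.cong refl) (use assms in \<open>auto simp: V6_basis_nth\<close>)
  then show ?thesis using assms by simp
qed

lemma inj_poly_of_V6:
  assumes "CHAR('a::field) = 7"
  shows "inj (poly_of_V6 :: 'a ^ 7 \<Rightarrow> _)"
proof (rule injI)
  fix u v :: "'a ^ 7" assume eq: "poly_of_V6 u = poly_of_V6 v"
  have coeff_add: "trunc_coeff (f + g) n = trunc_coeff f n + trunc_coeff g n" for f g :: "'a trunc_poly" and n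
    by transfer simp
  have coeff_smult: "trunc_coeff (trunc_smult c f) n = c * trunc_coeff f n" for c and f :: "'a trunc_poly" and n
    by transfer simp
  have coeff_sum: "trunc_coeff (sum h A) n = (\<Sum>i\<in>A. trunc_coeff (h i) n)"
    if "finite A" for A n and h :: "int \<Rightarrow> 'a trunc_poly"
    using that by (induction A rule: finite_induct) (simp_all add: coeff_add coeff_smult[of 0 0, simplified])
  have coeff: "trunc_coeff (poly_of_V6 w) (nat z) = w $ of_int z" if "z \<in> {0..6}" for w :: "'a ^ 7" and z
  proof -
    have "trunc_coeff (poly_of_V6 w) (nat z) = (\<Sum>i\<in>{0..6}. if i = z then w $ of_int i else 0)"
      unfolding poly_of_V6_def coeff_sum[OF finite_atLeastAtMost_int] coeff_smult trunc_coeff_monom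
      using that assms by (intro sum.cong) auto
    then show ?thesis using that by simp
  qed
  show "u = v"
    unfolding vec_eq_iff
  proof
    fix j :: 7
    show "u $ j = v $ j"
      using coeff[of _ u] coeff[of _ v] eq by (cases j) auto
  qed
qed

lemma poly_of_V6_act:
  assumes p: "CHAR('a::field) = 7"
  shows "poly_of_V6 (V6_act D v) = tensor_density 4 D (poly_of_V6 v :: 'a trunc_poly)"
proof -
  have basis: "poly_of_V6 (if 0 \<le> i + k \<and> i + k \<le> 6 then of_int (i + 4 * k + 4) *s V6_basis (i + k) else 0) =
      tensor_density 4 (witt_e k) (trunc_monom (nat i) :: 'a trunc_poly)" if "k \<in> {-1..5}" "i \<in> {0..6}" for i k
  proof -
    have k: "k = int (nat (k + 1)) - 1" and i: "i = int (nat i)" using that by auto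
    have range: "-1 \<le> k" "0 \<le> i" using that by auto
    have e: "tensor_density 4 (witt_e k) (trunc_monom (nat i) :: 'a trunc_poly) =
        trunc_smult (of_int (i + 4 * k + 4)) (trunc_monom (nat (k + 1) + nat i - 1))"
      by (subst k, subst tensor_density_e_monom) (use that in \<open>simp add: algebra_simps\<close>)
    consider "i = 0" "k = -1" | "0 \<le> i + k" "i + k \<le> 6" | "6 < i + k"
      using range by atomize_elim arith
    then show ?thesis
    proof cases
      case 2
      then have ik: "i + k \<in> {0..6}" "nat (k + 1) + nat i - 1 = nat (i + k)" using that by auto
      show ?thesis
        unfolding e if_P[OF conjI[OF 2]] poly_of_V6_scale poly_of_V6_basis[OF ik(1)] ik(2) ..
    next
      case 3
      then have "trunc_monom (nat (k + 1) + nat i - 1) = (0 :: 'a trunc_poly)"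
        using p that by (intro trunc_monom_eq_0) auto
      with 3 show ?thesis unfolding e by (simp add: poly_of_V6_zero)
    qed (unfold e, simp add: poly_of_V6_zero)
  qed
  have "poly_of_V6 (V6_act D v) = (\<Sum>k\<in>{-1..5::int}. \<Sum>i\<in>{0..6::int}. trunc_smult (witt_coeff D k * v $ of_int i)
      (tensor_density 4 (witt_e k) (trunc_monom (nat i))))"
    unfolding V6_act_def poly_of_V6_sum poly_of_V6_scale by (intro sum.cong refl arg_cong2[of _ _ _ _ trunc_smult] basis)
  also have "\<dots> = tensor_density 4 D (poly_of_V6 v)"
    by (subst tensor_density.act_expansion)
      (simp add: p poly_of_V6_def tensor_density.act_sum trunc_poly.scale_sum_right)
  finally show ?thesis .
qed

lemma witt_module_V6:
  assumes p: "CHAR('a::field) = 7"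
  shows "witt_module ((*s) :: 'a \<Rightarrow> 'a ^ 7 \<Rightarrow> _) V6_act"
proof (intro witt_module.intro witt_module_axioms.intro vec.vector_space_axioms)
  note [simp] = poly_of_V6_act[OF p] poly_of_V6_add poly_of_V6_scale tensor_density_left_add tensor_density_left_scale
  have diff: "poly_of_V6 (u - v) = poly_of_V6 u - poly_of_V6 v" for u v :: "'a ^ 7"
    using poly_of_V6_add[of "u - v" v] by simp
  have inj: "u = v" if "poly_of_V6 u = poly_of_V6 v" for u v :: "'a ^ 7"
    using inj_poly_of_V6[OF p] that by (rule injD)
  show "Vector_Spaces.linear (*s) (*s) (V6_act D :: 'a ^ 7 \<Rightarrow> _)" for D
    by (auto simp: Vector_Spaces.linear_iff vec.vector_space_axioms intro: inj)
  show "Vector_Spaces.linear witt_scale (*s) (\<lambda>D. V6_act D (v :: 'a ^ 7))" for v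
    by (auto simp: Vector_Spaces.linear_iff vec.vector_space_axioms witt.vector_space_axioms intro: inj)
  show "V6_act (witt_bracket D E) v = V6_act D (V6_act E v) - V6_act E (V6_act D v)" for D E and v :: "'a ^ 7"
    by (rule inj) (simp add: diff tensor_density_bracket)
qed

lemma V6_restricted:
  assumes p: "CHAR('a::field) = 7"
  shows "witt_restricted (V6_act :: 'a witt \<Rightarrow> _)"
  unfolding witt_restricted_def
proof (intro allI ext)
  fix D :: "'a witt" and v :: "'a ^ 7"
  have pow: "poly_of_V6 ((V6_act D ^^ n) v) = (tensor_density 4 D ^^ n) (poly_of_V6 v)" for n
    by (induction n) (simp_all add: poly_of_V6_act[OF p])
  have "(of_nat 7 :: 'a) = 0" using of_nat_CHAR[where ?'a = 'a] p by simp
  then have "(4 :: 'a) = - of_nat (Suc 2)" by (simp add: eq_neg_iff_add_eq_0)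
  then have "tensor_density 4 (witt_pmap D) g = (tensor_density 4 D ^^ 7) g" for g
    using tensor_density_restricted[OF p, of 2] by (simp only:)
  then have "poly_of_V6 (V6_act (witt_pmap D) v) = poly_of_V6 ((V6_act D ^^ 7) v)"
    by (simp add: pow poly_of_V6_act[OF p])
  then show "V6_act (witt_pmap D) v = (V6_act D ^^ CHAR('a)) v"
    using inj_poly_of_V6[OF p] p by (simp add: inj_eq)
qed

lemma density_module_V6:
  assumes p: "CHAR('a::field) = 7"
  shows "density_module (*s) V6_act (4 :: 'a) (\<lambda>i. if i < 7 then V6_basis (int i) else 0)"
proof -
  interpret witt_module "(*s) :: 'a \<Rightarrow> 'a ^ 7 \<Rightarrow> _" V6_act by (rule witt_module_V6[OF p])
  let ?m = "\<lambda>i. if i < 7 then V6_basis (int i) else (0 :: 'a ^ 7)"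
  have seven: "(7 :: 'a) = 0" using of_nat_CHAR[where ?'a = 'a] p by simp
  show ?thesis
  proof
    show "V6_act (witt_e (-1)) (?m i) = of_nat i *s ?m (i - 1)" for i
    proof -
      consider "i < 7" | "i = 7" | "7 < i" by linarith
      then show ?thesis
      proof cases
        case 1
        then show ?thesis by (subst (1) if_P, simp, subst V6_act_basis[OF p]) (auto simp: of_nat_diff)
      qed (auto simp: seven)
    qed
    show "V6_act (witt_e (int k)) (?m i) = (of_nat i + 4 * (of_nat k + 1)) *s ?m (i + k)" for i k
    proof (cases "i < 7")
      case True
      show ?thesis
      proof (cases "k < 6")
        case k: True
        with True show ?thesis by (subst (1) if_P, simp, subst V6_act_basis[OF p]) (auto simp: algebra_simps)
      next
        case False
        then have "witt_e (int k) = (0 :: 'a witt)" using p by (intro witt_e_eq_0) auto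
        moreover have "(of_nat i + 4 * (of_nat k + 1)) *s ?m (i + k) = 0"
        proof (cases "i + k < 7")
          case True
          then have "i = 0" "k = 6" using False by auto
          then have "of_nat i + 4 * (of_nat k + 1) = (4 * 7 :: 'a)" by simp
          then have "of_nat i + 4 * (of_nat k + 1) = (0 :: 'a)" unfolding seven by simp
          then show ?thesis by (simp only:) simp
        qed simp
        ultimately show ?thesis by simp
      qed
    qed simp
    show "?m i = 0" if "CHAR('a) \<le> i" for i using that p by simp
    have "V6_basis i \<in> range ?m" if "i \<in> {0..6}" for i
    proof (rule range_eqI)
      have "nat i < 7" "int (nat i) = i" using that by auto
      then show "V6_basis i = ?m (nat i)" by simp
    qed
    then have "v \<in> vec.span (range ?m)" for v :: "'a ^ 7"
      by (subst V6_expansion[of v]) (intro vec.span_sum vec.span_scale vec.span_base)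
    then show "vec.span (range ?m) = UNIV" by blast
  qed
qed


lemma V6_irreducible:
  assumes p: "CHAR('a::field) = 7"
  shows "witt_irreducible ((*s) :: 'a \<Rightarrow> 'a ^ 7 \<Rightarrow> _) V6_act"
proof -
  interpret density_module "(*s)" V6_act "4 :: 'a" "\<lambda>i. if i < 7 then V6_basis (int i) else 0"
    by (rule density_module_V6[OF p])
  have nz: "(of_nat n :: 'a) \<noteq> 0" if "0 < n" "n < 7" for n
    using that p by (auto simp: of_nat_eq_0_iff_char_dvd dest: dvd_imp_le)
  have "(4 :: 'a) \<noteq> 0" using nz[of 4] by simp
  moreover have "(3 :: 'a) \<noteq> 0" "(4 :: 'a) - 1 = 3" using nz[of 3] by simp_all
  then have "(4 :: 'a) \<noteq> 1" by (metis diff_self)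
  moreover have "V6_basis 0 \<noteq> (0 :: 'a ^ 7)" by (simp add: V6_basis_def axis_eq_0_iff)
  ultimately show ?thesis using p by (intro irreducible) simp_all
qed

lemma V6_not_trivial:
  assumes p: "CHAR('a::field) = 7"
  shows "\<not> witt_trivial ((*s) :: 'a \<Rightarrow> 'a ^ 7 \<Rightarrow> _) V6_act"
proof
  assume "witt_trivial ((*s) :: 'a \<Rightarrow> 'a ^ 7 \<Rightarrow> _) V6_act"
  then obtain \<phi> :: "'a ^ 7 \<Rightarrow> 'a" where lin: "Vector_Spaces.linear (*s) (*) \<phi>" and bij: "bij \<phi>"
    and zero: "\<And>D v. \<phi> (V6_act D v) = 0"
    unfolding witt_trivial_def witt_module_iso_def by blast
  have "\<phi> (0 *s 0) = 0 * \<phi> 0" using lin by (simp only: Vector_Spaces.linear_iff)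
  then have "\<phi> 0 = 0" by simp
  then have "V6_act (witt_e 0) (V6_basis 0) = (0 :: 'a ^ 7)"
    using zero bij by (metis bij_is_inj injD)
  then have "4 *s V6_basis 0 = (0 :: 'a ^ 7)"
    by (simp add: V6_act_basis[OF p])
  moreover have "(of_nat 4 :: 'a) \<noteq> 0"
    using p by (auto simp del: of_nat_numeral simp: of_nat_eq_0_iff_char_dvd dest: dvd_imp_le)
  ultimately show False by (simp add: V6_basis_def axis_eq_0_iff)
qed

text \<open>
  In \<open>V\<^sub>6\<close> the kernel of \<open>e\<^sub>-\<^sub>1\<close> contains a nonzero vector of weight \<open>4\<close>, in the adjoint module this
  kernel has weight \<open>-1\<close>, and \<open>4 \<noteq> -1\<close> in characteristic 7.
\<close>

lemma V6_not_adjoint: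
  assumes p: "CHAR('a::field) = 7"
  shows "\<not> witt_adjoint ((*s) :: 'a \<Rightarrow> 'a ^ 7 \<Rightarrow> _) V6_act"
proof
  assume "witt_adjoint ((*s) :: 'a \<Rightarrow> 'a ^ 7 \<Rightarrow> _) V6_act"
  then obtain \<phi> :: "'a ^ 7 \<Rightarrow> 'a witt" where lin: "Vector_Spaces.linear (*s) witt_scale \<phi>" and bij: "bij \<phi>"
    and hom: "\<And>D v. \<phi> (V6_act D v) = witt_bracket D (\<phi> v)"
    unfolding witt_adjoint_def witt_module_iso_def by blast
  have scale: "\<phi> (c *s v) = witt_scale c (\<phi> v)" for c v
    using lin by (simp add: Vector_Spaces.linear_iff)
  have \<phi>0: "\<phi> 0 = 0" using scale[of 0 0] by simp
  define D where "D = \<phi> (V6_basis 0)"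
  have low: "witt_bracket (witt_e (-1)) D = 0" and weight: "witt_bracket (witt_e 0) D = witt_scale 4 D"
    using hom[of "witt_e (-1)" "V6_basis 0"] hom[of "witt_e 0" "V6_basis 0"]
    by (simp_all add: V6_act_basis[OF p] D_def \<phi>0 scale)
  define g where "g = witt_apply D trunc_x"
  have e: "witt_apply (witt_e (-1)) f = trunc_pderiv f" "witt_apply (witt_e 0) f = trunc_x * trunc_pderiv f"
    for f :: "'a trunc_poly"
    by (simp_all add: witt_e.rep_eq trunc_one)
  have "trunc_pderiv g = 0"
  proof -
    have "witt_apply (witt_bracket (witt_e (-1)) D) trunc_x = trunc_pderiv g"
      by (simp add: witt_bracket.rep_eq e g_def trunc_pderiv_x is_derivation_one[OF witt_derivation])
    then show ?thesis by (simp add: low zero_witt.rep_eq)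
  qed
  moreover have "trunc_x * trunc_pderiv g - g = trunc_smult 4 g"
  proof -
    have "witt_apply (witt_bracket (witt_e 0) D) trunc_x = trunc_x * trunc_pderiv g - g"
      by (simp add: witt_bracket.rep_eq e g_def trunc_pderiv_x trunc_one)
    then show ?thesis by (simp add: weight witt_scale.rep_eq g_def)
  qed
  ultimately have "- g = trunc_smult 4 g" by simp
  then have "trunc_smult 4 g + g = 0" by (metis add.left_inverse)
  then have "trunc_smult (4 + 1) g = 0" by (simp only: trunc_poly.scale_left_distrib trunc_poly.scale_one)
  moreover have "(of_nat 5 :: 'a) \<noteq> 0"
    using p by (auto simp del: of_nat_numeral simp: of_nat_eq_0_iff_char_dvd dest: dvd_imp_le)
  ultimately have "g = 0" by simp
  then have "D = 0" by (intro witt_eqI) (simp add: g_def zero_witt.rep_eq)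
  then have "V6_basis 0 = (0 :: 'a ^ 7)"
    using bij \<phi>0 unfolding D_def by (metis bij_is_inj injD)
  then show False by (simp add: V6_basis_def axis_eq_0_iff)
qed

text \<open>
  The brackets of \<open>e\<^sub>-\<^sub>1\<close> with \<open>e\<^sub>2\<close> and \<open>e\<^sub>1\<close> give \<open>e\<^sub>1\<close> and \<open>e\<^sub>0\<close>, and then bracketing with
  \<open>e\<^sub>1\<close> climbs from \<open>e\<^sub>2\<close> to \<open>e\<^sub>p\<^sub>-\<^sub>2\<close>; the coefficients \<open>3\<close>, \<open>2\<close> and \<open>k - 1\<close> that
  occur are invertible.
\<close>

lemma witt_e_generated:
  assumes p: "CHAR('a::field) \<ge> 5" and base: "P (witt_e (-1) :: 'a witt)" "P (witt_e 2)"
    and bracket: "\<And>D E. P D \<Longrightarrow> P E \<Longrightarrow> P (witt_bracket D E)"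
    and scale: "\<And>c D. P D \<Longrightarrow> P (witt_scale c D)"
    and k: "k \<in> {-1..int CHAR('a) - 2}"
  shows "P (witt_e k)"
proof -
  have bracket_step: "P (witt_e (i + j))" if "P (witt_e i)" "P (witt_e j)" "-1 \<le> i" "i < j" "j < i + int CHAR('a)" for i j
  proof -
    have "(of_nat (nat (j - i)) :: 'a) \<noteq> 0"
      using that by (simp only: of_nat_eq_0_iff_char_dvd) (auto dest: dvd_imp_le)
    moreover have "(of_nat (nat (j - i)) :: 'a) = of_int (j - i)" using that by (intro of_nat_nat) simp
    ultimately have "(of_int (j - i) :: 'a) \<noteq> 0" by metis
    then have "witt_e (i + j) = witt_scale (inverse (of_int (j - i))) (witt_bracket (witt_e i) (witt_e j) :: 'a witt)"
      using that by (simp add: witt_bracket_e)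
    then show ?thesis using bracket scale that by simp
  qed
  have 1: "P (witt_e 1)" using bracket_step[of "-1" 2] base p by simp
  have 0: "P (witt_e 0)" using bracket_step[of "-1" 1] base 1 p by simp
  have up: "2 \<le> k \<Longrightarrow> k \<le> int CHAR('a) - 2 \<Longrightarrow> P (witt_e k)" for k
  proof (induction k rule: int_ge_induct)
    case (step k)
    then show ?case using bracket_step[of 1 k] 1 by (simp add: add.commute)
  qed (use base in simp)
  consider "k = -1" | "k = 0" | "k = 1" | "2 \<le> k" using k by fastforce
  then show ?thesis using base 0 1 up[of k] k by cases auto
qed

lemma (in density_module) invariant_productI:
  assumes p: "CHAR('a) \<ge> 5"
    and lin: "\<And>u. Vector_Spaces.linear scale scale (\<lambda>v. prd u v)" "\<And>v. Vector_Spaces.linear scale scale (\<lambda>u. prd u v)"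
    and basis: "\<And>k i j. k \<in> {-1, 2} \<Longrightarrow> i < CHAR('a) \<Longrightarrow> j < CHAR('a) \<Longrightarrow>
      act (witt_e k) (prd (m i) (m j)) = prd (act (witt_e k) (m i)) (m j) + prd (m i) (act (witt_e k) (m j))"
  shows "witt_invariant_product scale act prd"
proof -
  have prd: "prd (u + u') v = prd u v + prd u' v" "prd u (v + v') = prd u v + prd u v'"
    "prd (scale c u) v = scale c (prd u v)" "prd u (scale c v) = scale c (prd u v)" for u u' v v' c
    using lin(1)[of u] lin(2)[of v] by (simp_all add: Vector_Spaces.linear_iff)
  have prd0: "prd 0 v = 0" "prd u 0 = 0" for u v
    using prd(3)[of 0 0 v] prd(4)[of u 0 0] by simp_all
  have prd_sum: "prd (sum h A) v = (\<Sum>k\<in>A. prd (h k) v)" "prd u (sum h A) = (\<Sum>k\<in>A. prd u (h k))"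
    for u v and A :: "int set" and h
    by (induction A rule: infinite_finite_induct) (simp_all add: prd prd0)
  have gen: "act (witt_e k) (prd u v) = prd (act (witt_e k) u) v + prd u (act (witt_e k) v)"
    if k: "k \<in> {-1, 2}" for k u v
  proof -
    have basis': "act (witt_e k) (prd (m i) (m j)) = prd (act (witt_e k) (m i)) (m j) + prd (m i) (act (witt_e k) (m j))" for i j
      using basis[OF k, of i j] m_beyond[of i] m_beyond[of j] by (cases "i < CHAR('a) \<and> j < CHAR('a)") (auto simp: prd0 not_less)
    have "v \<in> span (range m)" by (simp add: span_m)
    then have left: "act (witt_e k) (prd (m i) v) = prd (act (witt_e k) (m i)) v + prd (m i) (act (witt_e k) v)" for i
      by (induction rule: span_induct_alt) (auto simp: prd prd0 basis' scale_right_distrib algebra_simps)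
    have "u \<in> span (range m)" by (simp add: span_m)
    then show ?thesis
      by (induction rule: span_induct_alt) (auto simp: prd prd0 left scale_right_distrib algebra_simps)
  qed
  have prd_diff: "prd (u - u') v = prd u v - prd u' v" "prd u (v - v') = prd u v - prd u v'" for u u' v v'
    by (simp_all add: eq_diff_eq flip: prd)
  have e: "act (witt_e k) (prd u v) = prd (act (witt_e k) u) v + prd u (act (witt_e k) v)"
    if "k \<in> {-1..int CHAR('a) - 2}" for k u v
  proof -
    have "\<forall>u v. act (witt_e k) (prd u v) = prd (act (witt_e k) u) v + prd u (act (witt_e k) v)"
      by (rule witt_e_generated[OF p _ _ _ _ that])
        (auto simp: gen act_bracket prd_diff prd act_scale_left scale_right_distrib)
    then show ?thesis by blast
  qed
  have "act D (prd u v) = prd (act D u) v + prd u (act D v)" for D u v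
    unfolding act_expansion[of D] prd_sum prd sum.distrib[symmetric]
    by (intro sum.cong refl) (simp add: e scale_right_distrib)
  with lin show ?thesis by (simp add: witt_invariant_product_def)
qed

text \<open>
  Invariance under \<open>e\<^sub>k\<close> of the product \<open>m\<^sub>i \<cdot> m\<^sub>j\<close>, read off as a congruence for the coefficient of
  \<open>m\<^sub>i\<^sub>+\<^sub>j\<^sub>+\<^sub>k\<^sub>-\<^sub>3\<close>; \<open>t k i\<close> is the coefficient in \<open>e\<^sub>k m\<^sub>i\<close>.
\<close>

lemma V6_structure_constants:
  assumes "k \<in> {-1, 2}" "i \<in> {0..6}" "j \<in> {0..6}"
  defines "t \<equiv> \<lambda>k i. if 0 \<le> i + k \<and> i + k \<le> 6 then i + 4 * k + 4 else (0 :: int)"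
  shows "(V6_c i j * t k ((i + j - 3) mod 7) - (t k i * V6_c (i + k) j + t k j * V6_c i (j + k))) mod 7 = 0"
proof -
  have "\<forall>k\<in>set [-1, 2]. \<forall>i\<in>set [0..6]. \<forall>j\<in>set [0..6].
      (V6_c i j * t k ((i + j - 3) mod 7) - (t k i * V6_c (i + k) j + t k j * V6_c i (j + k))) mod 7 = 0"
    unfolding t_def V6_c_def by code_simp
  moreover have "k \<in> set [-1, 2]" "i \<in> set [0..6]" "j \<in> set [0..6]"
    using assms(1-3) by auto
  ultimately show ?thesis by blast
qed

lemma V6_prod_linear:
  "Vector_Spaces.linear (*s) (*s) (\<lambda>v :: 'a::field ^ 7. V6_prod u v)"
  "Vector_Spaces.linear (*s) (*s) (\<lambda>u :: 'a::field ^ 7. V6_prod u v)"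
  by (simp_all add: Vector_Spaces.linear_iff vec.vector_space_axioms V6_prod_def vec.scale_sum_right
      vec.scale_left_distrib distrib_left distrib_right sum.distrib ac_simps)

lemma V6_prod_invariant:
  assumes p: "CHAR('a::field) = 7"
  shows "witt_invariant_product ((*s) :: 'a \<Rightarrow> 'a ^ 7 \<Rightarrow> _) V6_act V6_prod"
proof -
  interpret density_module "(*s)" V6_act "4 :: 'a" "\<lambda>i. if i < 7 then V6_basis (int i) else 0"
    by (rule density_module_V6[OF p])
  have prd: "V6_prod (c *s u) v = c *s V6_prod u v" "V6_prod u (c *s v) = c *s V6_prod u v"
    for c and u v :: "'a ^ 7"
    using V6_prod_linear(1)[of u] V6_prod_linear(2)[of v] by (simp_all add: Vector_Spaces.linear_iff)
  have periodic: "V6_basis (i mod 7) = (V6_basis i :: 'a ^ 7)" for i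
    by (simp add: V6_basis_def bit1.of_int_eq)
  define t where "t = (\<lambda>k i. if 0 \<le> i + k \<and> i + k \<le> 6 then i + 4 * k + 4 else (0 :: int))"
  have act: "V6_act (witt_e k) (V6_basis i) = (of_int (t k i) *s V6_basis (i + k) :: 'a ^ 7)"
    if "k \<in> {-1..5}" "i \<in> {0..6}" for k i
    using V6_act_basis[OF p that] by (simp add: t_def)
  have prod: "V6_prod (V6_basis i) (V6_basis j) = (of_int (V6_c i j) *s V6_basis (i + j - 3) :: 'a ^ 7)"
    if "i \<in> {0..6}" "j \<in> {0..6}" for i j
    using V6_prod_basis[OF that, where ?'a = 'a] by (simp only: periodic)
  have basis: "V6_act (witt_e k) (V6_prod (V6_basis i) (V6_basis j)) =
      V6_prod (V6_act (witt_e k) (V6_basis i)) (V6_basis j) + V6_prod (V6_basis i) (V6_act (witt_e k) (V6_basis j) :: 'a ^ 7)"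
    if k2: "k \<in> {-1, 2}" and i: "i \<in> {0..6}" and j: "j \<in> {0..6}" for k i j
  proof -
    have k: "k \<in> {-1..5}" using k2 by (elim insertE emptyE) simp_all
    let ?b = "V6_basis (i + j + k - 3) :: 'a ^ 7" and ?r = "(i + j - 3) mod 7"
    have r: "?r \<in> {0..6}"
      using pos_mod_bound[of 7 "i + j - 3"] by simp
    have base: "V6_basis (?r + k) = ?b"
    proof -
      have "i + j - 3 + k = i + j + k - 3" by simp
      then have "(?r + k) mod 7 = (i + j + k - 3) mod 7" by (simp only: mod_add_left_eq)
      then show ?thesis by (metis periodic)
    qed
    have "V6_act (witt_e k) (V6_prod (V6_basis i) (V6_basis j)) = of_int (V6_c i j) *s V6_act (witt_e k) (V6_basis ?r :: 'a ^ 7)"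
      by (simp only: prod[OF i j] periodic act_scale)
    then have lhs: "V6_act (witt_e k) (V6_prod (V6_basis i) (V6_basis j)) = of_int (V6_c i j * t k ?r) *s ?b"
      by (simp only: act[OF k r] base vec.scale_scale of_int_mult)
    have left: "of_int (t k i) *s V6_prod (V6_basis (i + k)) (V6_basis j) = of_int (t k i * V6_c (i + k) j) *s ?b"
      by (cases "i + k \<in> {0..6}") (use prod[of "i + k" j] j in \<open>auto simp: t_def algebra_simps\<close>)
    have right: "of_int (t k j) *s V6_prod (V6_basis i) (V6_basis (j + k)) = of_int (t k j * V6_c i (j + k)) *s ?b"
      by (cases "j + k \<in> {0..6}") (use prod[of i "j + k"] i in \<open>auto simp: t_def algebra_simps\<close>)
    have "(of_int (V6_c i j * t k ?r) :: 'a) - of_int (t k i * V6_c (i + k) j + t k j * V6_c i (j + k)) = 0"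
    proof -
      have "7 dvd V6_c i j * t k ?r - (t k i * V6_c (i + k) j + t k j * V6_c i (j + k))"
        using V6_structure_constants[OF k2 i j] unfolding t_def by (rule mod_0_imp_dvd)
      then obtain q where q: "V6_c i j * t k ?r - (t k i * V6_c (i + k) j + t k j * V6_c i (j + k)) = 7 * q" ..
      have "(7 :: 'a) = 0" using of_nat_CHAR[where ?'a = 'a] p by simp
      then show ?thesis unfolding of_int_diff[symmetric] q by simp
    qed
    then show ?thesis
      unfolding lhs act[OF k i] act[OF k j] prd left right vec.scale_left_distrib[symmetric] of_int_add[symmetric] by simp
  qed
  show ?thesis
  proof (rule invariant_productI[OF _ V6_prod_linear])
    show "5 \<le> CHAR('a)" using p by simp
    fix k :: int and i j :: nat
    assume k: "k \<in> {-1, 2}" and "i < CHAR('a)" "j < CHAR('a)"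
    then have ij: "i < 7" "j < 7" using p by simp_all
    then have "int i \<in> {0..6}" "int j \<in> {0..6}" by simp_all
    then show "V6_act (witt_e k) (V6_prod (if i < 7 then V6_basis (int i) else 0) (if j < 7 then V6_basis (int j) else 0)) =
        V6_prod (V6_act (witt_e k) (if i < 7 then V6_basis (int i) else 0)) (if j < 7 then V6_basis (int j) else 0) +
        V6_prod (if i < 7 then V6_basis (int i) else 0) (V6_act (witt_e k) (if j < 7 then V6_basis (int j) else 0) :: 'a ^ 7)"
      unfolding if_P[OF ij(1)] if_P[OF ij(2)] by (rule basis[OF k])
  qed
qed

lemma V6_module_with_product:
  assumes p: "CHAR('a::field) = 7"
  shows "witt_module_with_product ((*s) :: 'a \<Rightarrow> 'a ^ 7 \<Rightarrow> _) V6_act V6_prod"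
proof -
  \<comment> \<open>\<open>132 = c(0, 3)\<close> is congruent to \<open>6\<close> modulo 7.\<close>
  have "V6_prod (V6_basis 0) (V6_basis 3) = (132 *s V6_basis 0 :: 'a ^ 7)"
    by (subst V6_prod_basis) (simp_all add: V6_c_def)
  moreover have "(of_nat 132 :: 'a) \<noteq> 0"
    using p by (simp only: of_nat_eq_0_iff_char_dvd) simp
  ultimately have "V6_prod (V6_basis 0) (V6_basis 3) \<noteq> (0 :: 'a ^ 7)"
    by (simp add: V6_basis_def axis_eq_0_iff)
  then show ?thesis
    unfolding witt_module_with_product_def
    using witt_module_V6[OF p] V6_restricted[OF p] V6_irreducible[OF p] V6_not_trivial[OF p]
      V6_not_adjoint[OF p] V6_prod_invariant[OF p] by blast
qed


section \<open>Uniqueness\<close>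

lemma invariant_product_combination:
  assumes "vector_space s" and P: "witt_invariant_product s a P" and Q: "witt_invariant_product s a Q"
    and lin: "\<And>D. Vector_Spaces.linear s s (a D)"
  shows "witt_invariant_product s a (\<lambda>u v. P u v - s c (Q u v))"
proof -
  interpret vector_space s by fact
  have a: "a D (x - y) = a D x - a D y" "a D (s c x) = s c (a D x)" for D x y
  proof -
    interpret module_hom s s "a D" using lin[of D] by (simp add: Vector_Spaces.linear_def)
    show "a D (x - y) = a D x - a D y" "a D (s c x) = s c (a D x)" by (fact diff scale)+
  qed
  show ?thesis
    using invariant_productD[OF P] invariant_productD[OF Q]
    by (simp add: witt_invariant_product_def Vector_Spaces.linear_iff vector_space_axioms a
        scale_right_distrib scale_right_diff_distrib scale_left_commute)
qed

lemma invariant_product_transport: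
  assumes iso: "witt_module_iso s1 a1 s2 a2 \<phi>" and Q: "witt_invariant_product s2 a2 Q"
  shows "witt_invariant_product s1 a1 (\<lambda>u v. inv \<phi> (Q (\<phi> u) (\<phi> v)))"
proof -
  have lin: "\<phi> (x + y) = \<phi> x + \<phi> y" "\<phi> (s1 c x) = s2 c (\<phi> x)" and hom: "\<phi> (a1 D x) = a2 D (\<phi> x)"
    and vs: "vector_space s1" and bij: "bij \<phi>" for x y c D
    using iso by (simp_all add: witt_module_iso_def Vector_Spaces.linear_iff)
  have inj: "x = y" if "\<phi> x = \<phi> y" for x y using bij that by (simp add: bij_is_inj inj_eq)
  have [simp]: "\<phi> (inv \<phi> x) = x" for x using bij by (simp add: bij_is_surj surj_f_inv_f)
  show ?thesis
    using invariant_productD[OF Q]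
    by (auto simp: witt_invariant_product_def Vector_Spaces.linear_iff vs lin hom intro!: inj)
qed

text \<open>
  Pull the product of \<open>V\<^sub>6\<close> back to a product \<open>Q\<close> on the module. Subtracting a suitable multiple of
  \<open>Q\<close> from the given product makes the form vanish at \<open>(m 0, m 3)\<close>, hence everywhere, because the
  recursions determine the form by this value. So the difference of the products is zero.
\<close>

lemma unique_module_with_product:
  fixes scl :: "'a::field \<Rightarrow> 'v::ab_group_add \<Rightarrow> 'v"
  assumes M: "witt_module_with_product scl act prd" and p: "CHAR('a) \<ge> 5"
  shows "CHAR('a) = 7 \<and> (\<exists>\<phi> c. witt_module_iso scl act ((*s) :: 'a \<Rightarrow> 'a ^ 7 \<Rightarrow> 'a ^ 7) V6_act \<phi> \<and> c \<noteq> 0 \<and>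
           (\<forall>u v. \<phi> (prd u v) = c *s V6_prod (\<phi> u) (\<phi> v)))"
proof -
  interpret witt_module scl act using M by (simp add: witt_module_with_product_def)
  have irr: "witt_irreducible scl act" and inv: "witt_invariant_product scl act prd"
    and na: "\<not> witt_adjoint scl act"
    using M by (simp_all add: witt_module_with_product_def)
  obtain u0 v0 where nz: "prd u0 v0 \<noteq> 0" using M by (auto simp: witt_module_with_product_def)
  obtain b m where dm: "density_module scl act b m" and m0: "m 0 \<noteq> 0"
    and b: "b = -1 \<or> CHAR('a) = 7 \<and> b = 4"
    using invariant_product_classification[OF _ irr p _ inv nz] M
    unfolding witt_module_with_product_def by blast
  interpret density_module scl act b m by (rule dm)
  have "b \<noteq> -1"
  proof
    assume b: "b = -1"
    have "witt_e (int 0 - 1) \<noteq> (0 :: 'a witt)"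
    proof
      assume "witt_e (int 0 - 1) = (0 :: 'a witt)"
      then have "witt_coeff (witt_e (-1) :: 'a witt) (-1) = witt_coeff 0 (-1)" by simp
      then have "trunc_coeff (0 :: 'a trunc_poly) 0 = 1"
        using p by (simp add: witt_coeff_e) (simp add: witt_coeff_def zero_witt.rep_eq)
      moreover have "trunc_coeff (0 :: 'a trunc_poly) 0 = 0" by transfer simp
      ultimately show False by simp
    qed
    then obtain \<phi> where "witt_module_iso scl act witt_scale witt_bracket \<phi>"
      using density_modules_isomorphic[OF dm[unfolded b] density_module_adjoint[OF p] irr m0] by blast
    then show False using na by (auto simp: witt_adjoint_def)
  qed
  then have p7: "CHAR('a) = 7" and b4: "b = 4" using b by auto
  let ?m = "\<lambda>i. if i < 7 then V6_basis (int i) else (0 :: 'a ^ 7)"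
  have "?m 0 \<noteq> 0" by (simp add: V6_basis_def axis_eq_0_iff)
  then obtain \<phi> where iso: "witt_module_iso scl act ((*s) :: 'a \<Rightarrow> 'a ^ 7 \<Rightarrow> _) V6_act \<phi>"
    and \<phi>: "\<And>i. \<phi> (m i) = ?m i"
    using density_modules_isomorphic[OF dm[unfolded b4] density_module_V6[OF p7] irr m0] by blast
  have \<phi>_lin: "\<phi> (x + y) = \<phi> x + \<phi> y" "\<phi> (scl c x) = c *s \<phi> x" and bij: "bij \<phi>" for x y c
    using iso by (simp_all add: witt_module_iso_def Vector_Spaces.linear_iff)
  define Q where "Q u v = inv \<phi> (V6_prod (\<phi> u) (\<phi> v))" for u v
  have Q: "witt_invariant_product scl act Q"
    unfolding Q_def using iso V6_prod_invariant[OF p7] by (rule invariant_product_transport)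
  have \<phi>Q: "\<phi> (Q u v) = V6_prod (\<phi> u) (\<phi> v)" for u v
    using bij by (simp add: Q_def bij_is_surj surj_f_inv_f)
  obtain \<kappa> where \<kappa>: "is_coordinate 0 \<kappa>" using exists_coordinate[OF m0] .
  have \<kappa>_lin: "\<kappa> (x + y) = \<kappa> x + \<kappa> y" "\<kappa> (scl c x) = c * \<kappa> x" for x y c
    using \<kappa> by (simp_all add: Vector_Spaces.linear_iff is_coordinate_def)
  have "\<phi> (Q (m 0) (m 3)) = \<phi> (scl 132 (m 0))"
    unfolding \<phi>Q \<phi> \<phi>_lin by (simp add: V6_prod_basis V6_c_def)
  then have "Q (m 0) (m 3) = scl 132 (m 0)" using bij by (simp add: bij_is_inj inj_eq)
  moreover have "\<kappa> (m 0) = 1" using \<kappa> by (simp add: is_coordinate_def)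
  ultimately have "\<kappa> (Q (m 0) (m 3)) = 132" by (simp add: \<kappa>_lin)
  moreover have "(of_nat 132 :: 'a) \<noteq> 0"
    using p7 by (simp only: of_nat_eq_0_iff_char_dvd) simp
  ultimately have \<kappa>Q: "\<kappa> (Q (m 0) (m 3)) \<noteq> 0" by simp
  \<comment> \<open>The scalar for which the forms of \<open>prd\<close> and of \<open>c\<close> times \<open>Q\<close> agree at \<open>(m 0, m 3)\<close>.\<close>
  define c where "c = \<kappa> (prd (m 0) (m 3)) / \<kappa> (Q (m 0) (m 3))"
  let ?R = "\<lambda>u v. prd u v - scl c (Q u v)"
  have R: "witt_invariant_product scl act ?R"
    by (rule invariant_product_combination[OF vector_space_axioms inv Q linear_act])
  have "\<kappa> (x - y) = \<kappa> x - \<kappa> y" for x y using \<kappa>_lin(1)[of "x - y" y] by simp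
  then have R03: "\<kappa> (?R (m 0) (m 3)) = 0" using \<kappa>Q by (simp add: \<kappa>_lin c_def)
  have "(of_nat 7 :: 'a) = 0" using of_nat_CHAR[where ?'a = 'a] p7 by simp
  then have b3: "b = - of_nat 3" by (simp add: b4 eq_neg_iff_add_eq_0)
  have "\<kappa> (?R (m i) (m j)) = 0" for i j
    by (rule form_zero_generic[OF R \<kappa> _ p b3]) (use p7 R03 in auto)
  then have "?R u v = 0" for u v by (rule invariant_product_eq_0[OF irr R \<kappa>])
  then have eq: "prd u v = scl c (Q u v)" for u v by simp
  then have "c \<noteq> 0" using nz by auto
  moreover have "\<phi> (prd u v) = c *s V6_prod (\<phi> u) (\<phi> v)" for u v by (simp add: eq \<phi>_lin \<phi>Q)
  ultimately show ?thesis using p7 iso by blast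
qed

theorem theorem4:
  fixes p :: nat
  assumes "CHAR('a::alg_closed_field) = p" and "p \<ge> 5"
  shows
    "(p \<noteq> 7 \<longrightarrow>
       \<not> (\<exists>(scl :: 'a \<Rightarrow> 'v::ab_group_add \<Rightarrow> 'v) act prd. witt_module_with_product scl act prd)) \<and>
     (p = 7 \<longrightarrow>
       witt_module_with_product ((*s) :: 'a \<Rightarrow> 'a ^ 7 \<Rightarrow> 'a ^ 7) V6_act V6_prod \<and>
       (\<forall>(scl :: 'a \<Rightarrow> 'v::ab_group_add \<Rightarrow> 'v) act prd. witt_module_with_product scl act prd \<longrightarrow>
         (\<exists>\<phi> c. witt_module_iso scl act ((*s) :: 'a \<Rightarrow> 'a ^ 7 \<Rightarrow> 'a ^ 7) V6_act \<phi> \<and> c \<noteq> 0 \<and>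
           (\<forall>u v. \<phi> (prd u v) = c *s V6_prod (\<phi> u) (\<phi> v)))))"
proof (intro conjI impI allI notI)
  show False if "p \<noteq> 7" "\<exists>(scl :: 'a \<Rightarrow> 'v \<Rightarrow> 'v) act prd. witt_module_with_product scl act prd"
    using that unique_module_with_product[where ?'a = 'a and ?'v = 'v] assms by blast
  show "witt_module_with_product ((*s) :: 'a \<Rightarrow> 'a ^ 7 \<Rightarrow> 'a ^ 7) V6_act V6_prod" if "p = 7"
    using that assms by (intro V6_module_with_product) simp
  fix scl :: "'a \<Rightarrow> 'v \<Rightarrow> 'v" and act prd
  assume "witt_module_with_product scl act prd"
  then show "\<exists>\<phi> c. witt_module_iso scl act ((*s) :: 'a \<Rightarrow> 'a ^ 7 \<Rightarrow> 'a ^ 7) V6_act \<phi> \<and> c \<noteq> 0 \<and>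
           (\<forall>u v. \<phi> (prd u v) = c *s V6_prod (\<phi> u) (\<phi> v))"
    using unique_module_with_product assms by blast
qed

end
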